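(* Let $\mathcal{H}$ be a complex separable Hilbert space and let $T \in \mathscr{B}(\mathcal{H})$. Then $T$ is essentially idempotent, i.e. $T^2 - T \in \mathcal{K}(\mathcal{H})$, if and only if one of the following holds: (1) $T - I \in \mathcal{K}(\mathcal{H})$. (2) $T \in \mathcal{K}(\mathcal{H})$. (3) $T - S \in \mathcal{K}(\mathcal{H})$ for some idempotent $S \in \mathscr{B}(\mathcal{H})$ such that both $\mathcal{R}(S)$ and $\mathcal{N}(S^* )$ are infinite-dimensional.
   Context: $\mathscr{B}(\mathcal{H})$ denotes the algebra of bounded linear operators on $\mathcal{H}$ and $\mathcal{K}(\mathcal{H})$ the closed ideal of compact operators. $S$ is idempotent if $S^2 = S$ (not necessarily self-adjoint). $\mathcal{R}(S)$ and $\mathcal{N}(S)$ denote the range and null space of $S$, and $\mathcal{N}(S^* ) = \mathcal{R}(S)^\perp$. *)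

theory Defs
  imports "HOL-Analysis.Analysis"
begin

(* The library has only real vector and inner product spaces.  A complex Hilbert space is
   rendered as a type carrying a complex scalar multiplication and a complex inner product
   (linear in the first argument) whose restriction to real scalars, respectively whose real
   part, is the library's real structure.  The norm is then sqrt (Re (cinner x x)), and the
   library's topology, completeness and boundedness apply. *)

class complex_vector = real_vector +
  fixes scaleC :: "complex \<Rightarrow> 'a \<Rightarrow> 'a" (infixr "*\<^sub>C" 75)
  assumes scaleC_add_right: "a *\<^sub>C (x + y) = a *\<^sub>C x + a *\<^sub>C y"
    and scaleC_add_left: "(a + b) *\<^sub>C x = a *\<^sub>C x + b *\<^sub>C x"
    and scaleC_scaleC: "a *\<^sub>C (b *\<^sub>C x) = (a * b) *\<^sub>C x"
    and scaleR_scaleC: "r *\<^sub>R x = complex_of_real r *\<^sub>C x"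

class complex_inner = complex_vector + real_inner +
  fixes cinner :: "'a \<Rightarrow> 'a \<Rightarrow> complex"
  assumes cinner_commute: "cinner x y = cnj (cinner y x)"
    and cinner_add_left: "cinner (x + y) z = cinner x z + cinner y z"
    and cinner_scaleC_left: "cinner (c *\<^sub>C x) y = c * cinner x y"
    and inner_eq_Re_cinner: "inner x y = Re (cinner x y)"

class complex_hilbert = complex_inner + complete_space

instantiation complex :: complex_hilbert
begin

definition scaleC_complex :: "complex \<Rightarrow> complex \<Rightarrow> complex"
  where "scaleC_complex c z = c * z"

definition cinner_complex :: "complex \<Rightarrow> complex \<Rightarrow> complex"
  where "cinner_complex z w = z * cnj w"

instance
  by standard
    (simp_all add: scaleC_complex_def cinner_complex_def algebra_simps scaleR_conv_of_real
      inner_complex_def)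

end

interpretation complex_vector: vector_space "scaleC :: complex \<Rightarrow> 'a \<Rightarrow> 'a::complex_vector"
proof
  show "1 *\<^sub>C x = x" for x :: 'a
    using scaleR_scaleC[of 1 x] by simp
qed (simp_all add: scaleC_add_right scaleC_add_left scaleC_scaleC)

definition bounded_clinear :: "('a::complex_inner \<Rightarrow> 'b::complex_inner) \<Rightarrow> bool"
  where "bounded_clinear f \<longleftrightarrow> bounded_linear f \<and> (\<forall>c x. f (c *\<^sub>C x) = c *\<^sub>C f x)"

definition compact_operator :: "('a::complex_inner \<Rightarrow> 'b::complex_inner) \<Rightarrow> bool"
  where "compact_operator K \<longleftrightarrow> bounded_clinear K \<and> compact (closure (K ` cball 0 1))"

(* On a complete space the adjoint of a bounded operator exists by the Riesz representation
   theorem; the identity below determines it uniquely. *)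
definition cadjoint :: "('a::complex_inner \<Rightarrow> 'b::complex_inner) \<Rightarrow> 'b \<Rightarrow> 'a"
  where "cadjoint S = (THE A. \<forall>x y. cinner (S x) y = cinner x (A y))"

definition null_space :: "('a::complex_inner \<Rightarrow> 'b::complex_inner) \<Rightarrow> 'a set"
  where "null_space S = {x. S x = 0}"

(* Intended for complex-linear subspaces V; the span is over the complex scalars. *)
definition infinite_dimensional :: "'a::complex_vector set \<Rightarrow> bool"
  where "infinite_dimensional V \<longleftrightarrow> \<not> (\<exists>B. finite B \<and> V = complex_vector.span B)"

definition idempotent_operator :: "('a::complex_inner \<Rightarrow> 'a) \<Rightarrow> bool"
  where "idempotent_operator S \<longleftrightarrow> bounded_clinear S \<and> S \<circ> S = S"

definition essentially_idempotent :: "('a::complex_inner \<Rightarrow> 'a) \<Rightarrow> bool"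
  where "essentially_idempotent T \<longleftrightarrow> compact_operator (\<lambda>x. (T \<circ> T) x - T x)"

end

theory Submission
  imports Defs "HOL-Complex_Analysis.Complex_Analysis"
begin

text \<open>Only the lifting of an idempotent modulo the compact operators is hard. Let \<open>K = T\<^sup>2 - T\<close> be
  compact. Some closed \<open>K\<close>- and \<open>T\<close>-invariant subspace \<open>F\<close> with compact orthogonal projection absorbs
  all spectral values of \<open>K\<close> of modulus at least \<open>1/16\<close>. Compressing to the orthogonal complement of
  \<open>F\<close> changes \<open>T\<close> by a compact operator and preserves the relation \<open>T\<^sup>2 - T = K\<close>; for the compressed
  \<open>K\<close> the powers of \<open>4 K\<close> decay geometrically, by the maximum principle applied to the resolvent.
  Hence the binomial series for \<open>(1 + 4 K)\<^bsup>-1/2\<^esup>\<close> converges. As \<open>(2 T - 1)\<^sup>2 = 1 + 4 K\<close>, the operator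
  \<open>(2 T - 1) (1 + 4 K)\<^bsup>-1/2\<^esup>\<close> is an involution \<open>Y\<close>, and \<open>S = (1 + Y) / 2\<close> is the required idempotent.
  If its range or cokernel is finite-dimensional, then \<open>S\<close> or \<open>1 - S\<close> is compact.\<close>

instance complex_hilbert \<subseteq> banach ..

section \<open>Complex inner product spaces\<close>

lemma cinner_add_right: "cinner x (y + z) = cinner x y + cinner x z"
  using cinner_add_left[of y z x]
  by (simp add: cinner_commute[of x y] cinner_commute[of x z] cinner_commute[of x "y + z"])

lemma cinner_scaleC_right: "cinner x (c *\<^sub>C y) = cnj c * cinner x y"
  by (simp add: cinner_commute[of x y] cinner_commute[of x "c *\<^sub>C y"] cinner_scaleC_left)

lemma cinner_zero_left [simp]: "cinner 0 y = 0"
  using cinner_add_left[of 0 0 y] by simp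

lemma cinner_zero_right [simp]: "cinner x 0 = 0"
  using cinner_add_right[of x 0 0] by simp

lemma cinner_minus_left: "cinner (- x) y = - cinner x y"
  using cinner_add_left[of x "- x" y] by (simp add: add_eq_0_iff)

lemma cinner_minus_right: "cinner x (- y) = - cinner x y"
  using cinner_add_right[of x y "- y"] by (simp add: add_eq_0_iff)

lemma cinner_diff_left: "cinner (x - y) z = cinner x z - cinner y z"
  using cinner_add_left[of x "- y" z] by (simp add: cinner_minus_left)

lemma cinner_diff_right: "cinner x (y - z) = cinner x y - cinner x z"
  using cinner_add_right[of x y "- z"] by (simp add: cinner_minus_right)

lemma cinner_self: "cinner x x = complex_of_real ((norm x)\<^sup>2)"
proof -
  have "Im (cinner x x) = 0"
    using arg_cong[OF cinner_commute[of x x], of Im] by simp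
  moreover have "Re (cinner x x) = (norm x)\<^sup>2"
    by (metis inner_eq_Re_cinner power2_norm_eq_inner)
  ultimately show ?thesis
    by (simp add: complex_eq_iff)
qed

lemma norm_scaleC: "norm (c *\<^sub>C x) = cmod c * norm (x :: 'a::complex_inner)"
proof -
  have "complex_of_real ((norm (c *\<^sub>C x))\<^sup>2) = complex_of_real ((cmod c * norm x)\<^sup>2)"
    unfolding cinner_self[symmetric] cinner_scaleC_left cinner_scaleC_right
    using complex_norm_square[of c] by (simp add: cinner_self power_mult_distrib mult.commute)
  then have "(norm (c *\<^sub>C x))\<^sup>2 = (cmod c * norm x)\<^sup>2"
    using of_real_eq_iff by blast
  then show ?thesis
    by (simp add: power2_eq_iff_nonneg)
qed

lemma cinner_norm_le: "cmod (cinner x y) \<le> norm x * norm y"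
proof (cases "cinner x y = 0")
  case False
  \<comment> \<open>The unimodular \<open>c\<close> rotates \<open>cinner x y\<close> to its
    modulus, so the real Cauchy-Schwarz inequality for \<open>inner\<close> already bounds the
    complex product.\<close>
  define c where "c = cnj (cinner x y) / cmod (cinner x y)"
  have c: "cmod c = 1"
    using False by (simp add: c_def norm_divide)
  have "c * cinner x y = cmod (cinner x y)"
    using False complex_norm_square[of "cinner x y"]
    by (simp add: c_def field_simps power2_eq_square)
  then have "cmod (cinner x y) = inner (c *\<^sub>C x) y"
    by (simp add: inner_eq_Re_cinner cinner_scaleC_left)
  also have "\<dots> \<le> norm (c *\<^sub>C x) * norm y"
    by (rule norm_cauchy_schwarz)
  finally show ?thesis
    by (simp add: norm_scaleC c)
qed simp

lemma bounded_bilinear_scaleC: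
  "bounded_bilinear (scaleC :: complex \<Rightarrow> 'a \<Rightarrow> 'a::complex_inner)"
proof
  show "(r *\<^sub>R a) *\<^sub>C b = r *\<^sub>R (a *\<^sub>C b)" for r a and b :: 'a
    unfolding scaleR_scaleC[of r "a *\<^sub>C b"] by (simp add: scaleC_scaleC scaleR_conv_of_real)
  show "\<exists>K. \<forall>a (b::'a). norm (a *\<^sub>C b) \<le> norm a * norm b * K"
    by (rule exI[of _ 1]) (simp add: norm_scaleC)
qed (simp_all add: scaleC_add_left scaleC_add_right scaleR_scaleC scaleC_scaleC
      complex_vector.scale_left_commute scaleR_conv_of_real)

lemma bounded_bilinear_cinner:
  "bounded_bilinear (cinner :: 'a::complex_inner \<Rightarrow> 'a \<Rightarrow> complex)"
proof
  show "\<exists>K. \<forall>a b::'a. norm (cinner a b) \<le> norm a * norm b * K"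
    by (rule exI[of _ 1]) (simp add: cinner_norm_le)
qed (simp_all add: cinner_add_left cinner_add_right scaleR_scaleC cinner_scaleC_left
      cinner_scaleC_right scaleC_complex_def)

lemma cinner_eq_zero_all: "(\<And>x. cinner x y = 0) \<Longrightarrow> y = 0"
  using cinner_self[of y] by simp

section \<open>Bounded complex-linear and compact operators\<close>

lemma bounded_clinear_imp_bounded_linear: "bounded_clinear f \<Longrightarrow> bounded_linear f"
  by (simp add: bounded_clinear_def)

lemma bounded_clinear_scaleC: "bounded_clinear f \<Longrightarrow> f (c *\<^sub>C x) = c *\<^sub>C f x"
  by (simp add: bounded_clinear_def)

lemma bounded_clinear_add: "bounded_clinear f \<Longrightarrow> f (x + y) = f x + f y"
  using bounded_clinear_imp_bounded_linear bounded_linear.axioms(1) linear_add by blast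

lemma bounded_clinear_diff: "bounded_clinear f \<Longrightarrow> f (x - y) = f x - f y"
  using bounded_clinear_imp_bounded_linear bounded_linear.axioms(1) linear_diff by blast

lemma bounded_clinear_zero: "bounded_clinear f \<Longrightarrow> f 0 = 0"
  using bounded_clinear_imp_bounded_linear bounded_linear.axioms(1) linear_0 by blast

lemma bounded_clinearI:
  assumes "\<And>x y. f (x + y) = f x + f y" "\<And>c x. f (c *\<^sub>C x) = c *\<^sub>C f x"
    and "\<And>x. norm (f x) \<le> norm x * C"
  shows "bounded_clinear f"
  unfolding bounded_clinear_def
proof (intro conjI allI)
  show "bounded_linear f"
    by (rule bounded_linear_intro[of f C]) (simp_all add: assms scaleR_scaleC)
qed (rule assms(2))

lemma bounded_clinear_id: "bounded_clinear (\<lambda>x. x)"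
  by (simp add: bounded_clinear_def)

lemma bounded_clinear_const_zero: "bounded_clinear (\<lambda>x. 0)"
  by (simp add: bounded_clinear_def)

lemma bounded_clinear_compose:
  "bounded_clinear f \<Longrightarrow> bounded_clinear g \<Longrightarrow> bounded_clinear (\<lambda>x. f (g x))"
  by (simp add: bounded_clinear_def bounded_linear_compose)

lemma bounded_clinear_plus:
  "bounded_clinear f \<Longrightarrow> bounded_clinear g \<Longrightarrow> bounded_clinear (\<lambda>x. f x + g x)"
  by (simp add: bounded_clinear_def bounded_linear_add scaleC_add_right)

lemma bounded_clinear_minus:
  "bounded_clinear f \<Longrightarrow> bounded_clinear g \<Longrightarrow> bounded_clinear (\<lambda>x. f x - g x)"
  by (simp add: bounded_clinear_def bounded_linear_sub complex_vector.scale_right_diff_distrib)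

lemma bounded_clinear_scaled:
  assumes "bounded_clinear f"
  shows "bounded_clinear (\<lambda>x. c *\<^sub>C f x)"
proof -
  have "bounded_linear (\<lambda>x. c *\<^sub>C f x)"
    using bounded_linear_compose[OF bounded_bilinear.bounded_linear_right[OF bounded_bilinear_scaleC]]
      assms bounded_clinear_imp_bounded_linear by blast
  then show ?thesis
    using assms by (simp add: bounded_clinear_def complex_vector.scale_left_commute)
qed

section \<open>Compact operators as a two-sided ideal\<close>

lemma compact_operator_clinear: "compact_operator K \<Longrightarrow> bounded_clinear K"
  by (simp add: compact_operator_def)

lemma compact_operatorI:
  assumes "bounded_clinear K" "compact C" "\<And>x. norm x \<le> 1 \<Longrightarrow> K x \<in> C"
  shows "compact_operator K"
  unfolding compact_operator_def
proof
  have "closure (K ` cball 0 1) \<subseteq> C"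
    using assms(2,3) by (intro closure_minimal compact_imp_closed) auto
  then show "compact (closure (K ` cball 0 1))"
    using assms(2) compact_Int_closed[of C "closure (K ` cball 0 1)"] by (simp add: Int_absorb1)
qed (rule assms(1))

lemma compact_operatorE:
  assumes "compact_operator K"
  obtains C where "compact C" "\<And>x. norm x \<le> 1 \<Longrightarrow> K x \<in> C"
proof
  show "K x \<in> closure (K ` cball 0 1)" if "norm x \<le> 1" for x
    using that closure_subset[of "K ` cball 0 1"] by (auto simp: image_subset_iff)
qed (use assms in \<open>simp add: compact_operator_def\<close>)

lemma compact_operator_plus:
  assumes "compact_operator f" "compact_operator g"
  shows "compact_operator (\<lambda>x. f x + g x)"
proof -
  obtain C D where "compact C" "\<And>x. norm x \<le> 1 \<Longrightarrow> f x \<in> C"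
      "compact D" "\<And>x. norm x \<le> 1 \<Longrightarrow> g x \<in> D"
    using assms by (metis compact_operatorE)
  then show ?thesis
    using compact_sums[of C D]
    by (intro compact_operatorI[of _ "{x + y |x y. x \<in> C \<and> y \<in> D}", OF bounded_clinear_plus[OF
          compact_operator_clinear[OF assms(1)] compact_operator_clinear[OF assms(2)]]]) auto
qed

lemma compact_operator_left:
  assumes "bounded_clinear A" "compact_operator f"
  shows "compact_operator (\<lambda>x. A (f x))"
proof -
  obtain C where C: "compact C" "\<And>x. norm x \<le> 1 \<Longrightarrow> f x \<in> C"
    using assms by (metis compact_operatorE)
  then have "compact (A ` C)"
    using assms(1) bounded_clinear_imp_bounded_linear compact_continuous_image
      linear_continuous_on by blast
  then show ?thesis
    using C
    by (intro compact_operatorI[of _ "A ` C", OF bounded_clinear_compose[OF assms(1)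
          compact_operator_clinear[OF assms(2)]]]) auto
qed

lemma compact_operator_scaled:
  "compact_operator f \<Longrightarrow> compact_operator (\<lambda>x. c *\<^sub>C f x)"
  using compact_operator_left[OF bounded_clinear_scaled[OF bounded_clinear_id]] .

lemma compact_operator_minus:
  assumes "compact_operator f" "compact_operator g"
  shows "compact_operator (\<lambda>x. f x - g x)"
  using compact_operator_plus[OF assms(1) compact_operator_scaled[OF assms(2), of "- 1"]] by simp

lemma compact_operator_right:
  assumes "compact_operator f" "bounded_clinear A"
  shows "compact_operator (\<lambda>x. f (A x))"
proof -
  obtain C where C: "compact C" "\<And>x. norm x \<le> 1 \<Longrightarrow> f x \<in> C"
    using assms by (metis compact_operatorE)
  obtain b where b: "b > 0" "\<And>x. norm (A x) \<le> norm x * b"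
    using bounded_linear.pos_bounded assms(2) bounded_clinear_imp_bounded_linear by blast
  have "compact ((\<lambda>y. b *\<^sub>R y) ` C)"
    using C(1) by (rule compact_scaling)
  moreover have "f (A x) \<in> (\<lambda>y. b *\<^sub>R y) ` C" if "norm x \<le> 1" for x
  proof -
    have "norm (A x) \<le> b"
      using b(2)[of x] that b(1) by (meson mult_left_le_one_le norm_ge_zero order_trans less_imp_le)
    then have "norm ((1/b) *\<^sub>R A x) \<le> 1"
      using b by (simp add: field_simps)
    moreover have "f (A x) = b *\<^sub>R f ((1/b) *\<^sub>R A x)"
      using b bounded_clinear_scaleC[OF compact_operator_clinear[OF assms(1)]]
      by (simp add: scaleR_scaleC scaleC_scaleC)
    ultimately show ?thesis
      using C(2) by blast
  qed
  ultimately show ?thesis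
    using compact_operatorI[OF bounded_clinear_compose[OF compact_operator_clinear[OF assms(1)] assms(2)]]
    by blast
qed

lemma compact_operator_zero: "compact_operator (\<lambda>x. 0)"
  by (rule compact_operatorI[of _ "{0}"]) (simp_all add: bounded_clinear_const_zero)

lemma compact_operator_rank_one: "compact_operator (\<lambda>x. cinner x a *\<^sub>C b)"
proof (rule compact_operatorI)
  show "bounded_clinear (\<lambda>x. cinner x a *\<^sub>C b)"
    by (rule bounded_clinearI[of _ "norm a * norm b"])
      (simp_all add: cinner_add_left cinner_scaleC_left scaleC_add_left scaleC_scaleC norm_scaleC
        cinner_norm_le mult_right_mono flip: mult.assoc)
  show "compact ((\<lambda>c. c *\<^sub>C b) ` cball 0 (norm a))"
    using bounded_bilinear.bounded_linear_left[OF bounded_bilinear_scaleC]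
    by (intro compact_continuous_image linear_continuous_on) auto
  show "cinner x a *\<^sub>C b \<in> (\<lambda>c. c *\<^sub>C b) ` cball 0 (norm a)" if "norm x \<le> 1" for x
  proof -
    have "cmod (cinner x a) \<le> norm a"
      using cinner_norm_le[of x a] that by (meson mult_left_le_one_le norm_ge_zero order_trans)
    then show ?thesis
      by auto
  qed
qed

lemma compact_operator_convergent_subseq:
  fixes x :: "nat \<Rightarrow> 'a::complex_inner"
  assumes "compact_operator K" "\<And>n. norm (x n) \<le> 1"
  shows "\<exists>r l. strict_mono r \<and> (\<lambda>n. K (x (r n))) \<longlonglongrightarrow> l"
proof -
  obtain C where C: "compact C" "\<And>x. norm x \<le> 1 \<Longrightarrow> K x \<in> C"
    using assms(1) by (rule compact_operatorE) (rule that)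
  have "\<forall>n. K (x n) \<in> C"
    using C(2) assms(2) by simp
  then have "\<exists>l r. strict_mono r \<and> ((\<lambda>n. K (x n)) \<circ> r) \<longlonglongrightarrow> l"
    using C(1)[unfolded compact_def, THEN spec, of "\<lambda>n. K (x n)"] by blast
  then obtain l r where "strict_mono r" "((\<lambda>n. K (x n)) \<circ> r) \<longlonglongrightarrow> l"
    by blast
  then show ?thesis
    by (auto simp: o_def)
qed

section \<open>Orthogonal projections and adjoints\<close>

text \<open>A minimising sequence for the distance to \<open>V\<close> is Cauchy by the
  parallelogram law. Its limit is a nearest point, and minimality along every real line through it
  inside \<open>V\<close> forces orthogonality.\<close>

lemma orthogonal_decomposition:
  fixes V :: "'a::complex_hilbert set"
  assumes V: "complex_vector.subspace V" "closed V"
  shows "\<exists>p\<in>V. \<forall>v\<in>V. cinner (x - p) v = 0"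
proof -
  define d where "d = infdist x V"
  have ne: "V \<noteq> {}"
    using V(1) complex_vector.subspace_0 by blast
  have d_le: "d \<le> norm (x - v)" if "v \<in> V" for v
    using infdist_le[OF that, of x] by (simp add: d_def dist_norm)
  have d0: "d \<ge> 0"
    by (simp add: d_def infdist_nonneg)
  have "\<exists>v\<in>V. norm (x - v) < d + 1 / Suc n" for n
  proof -
    have "infdist x V < d + 1 / Suc n"
      by (simp add: d_def)
    then show ?thesis
      unfolding infdist_notempty[OF ne] by (subst (asm) cInf_less_iff) (use ne in \<open>auto simp: dist_norm intro!: bdd_belowI[of _ 0]\<close>)
  qed
  then obtain v where v: "\<And>n. v n \<in> V" "\<And>n. norm (x - v n) < d + 1 / Suc n"
    by metis
  have half: "(1/2) *\<^sub>R (a + b) \<in> V" if "a \<in> V" "b \<in> V" for a b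
    using that V(1) by (simp add: scaleR_scaleC complex_vector.subspace_add complex_vector.subspace_scale)
  \<comment> \<open>Parallelogram law for \<open>x - a\<close> and \<open>x - b\<close>: the
    midpoint of \<open>a\<close> and \<open>b\<close> lies in \<open>V\<close>, hence at distance at
    least \<open>d\<close> from \<open>x\<close>.\<close>
  have para: "(norm (a - b))\<^sup>2 \<le> 2 * (norm (x - a))\<^sup>2 + 2 * (norm (x - b))\<^sup>2 - 4 * d\<^sup>2"
    if "a \<in> V" "b \<in> V" for a b
  proof -
    have "x - (1/2) *\<^sub>R (a + b) = (1/2) *\<^sub>R ((x - a) + (x - b))"
      by (simp add: algebra_simps flip: scaleR_add_left)
    then have "d\<^sup>2 \<le> (norm ((1/2) *\<^sub>R ((x - a) + (x - b))))\<^sup>2"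
      using d_le[OF half[OF that]] d0 by (metis power_mono)
    then have "4 * d\<^sup>2 \<le> (norm ((x - a) + (x - b)))\<^sup>2"
      by (simp add: power_divide)
    moreover have "(norm ((x - a) + (x - b)))\<^sup>2 + (norm (a - b))\<^sup>2
        = 2 * (norm (x - a))\<^sup>2 + 2 * (norm (x - b))\<^sup>2"
      unfolding power2_norm_eq_inner by (simp add: inner_diff inner_add inner_commute)
    ultimately show ?thesis
      by linarith
  qed
  have "Cauchy v"
  proof (rule CauchyI)
    fix e :: real assume e: "e > 0"
    have "(\<lambda>n. 4 * (d + 1 / Suc n)\<^sup>2 - 4 * d\<^sup>2) \<longlonglongrightarrow> 4 * (d + 0)\<^sup>2 - 4 * d\<^sup>2"
      by (intro tendsto_intros LIMSEQ_inverse_real_of_nat[unfolded inverse_eq_divide])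
    then have "\<forall>\<^sub>F n in sequentially. 4 * (d + 1 / Suc n)\<^sup>2 - 4 * d\<^sup>2 < e\<^sup>2"
      using e by (intro order_tendstoD(2)) auto
    then obtain N where N: "4 * (d + 1 / Suc N)\<^sup>2 - 4 * d\<^sup>2 < e\<^sup>2"
      by (auto simp: eventually_sequentially)
    have b: "(norm (x - v n))\<^sup>2 \<le> (d + 1 / Suc N)\<^sup>2" if "n \<ge> N" for n
    proof -
      have "1 / real (Suc n) \<le> 1 / real (Suc N)"
        using that by (intro divide_left_mono) auto
      then show ?thesis
        using v(2)[of n] by (intro power_mono) auto
    qed
    have "norm (v m - v n) < e" if "m \<ge> N" "n \<ge> N" for m n
      using para[OF v(1)[of m] v(1)[of n]] b[OF that(1)] b[OF that(2)] N e
      by (intro power_less_imp_less_base[of _ 2 e]) auto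
    then show "\<exists>M. \<forall>m\<ge>M. \<forall>n\<ge>M. norm (v m - v n) < e"
      by blast
  qed
  then obtain p where p: "v \<longlonglongrightarrow> p"
    using Cauchy_convergent convergent_def by blast
  have pV: "p \<in> V"
    using V(2) v(1) p closed_sequentially by blast
  have "(\<lambda>n. d + 1 / Suc n) \<longlonglongrightarrow> d + 0"
    by (intro tendsto_intros LIMSEQ_inverse_real_of_nat[unfolded inverse_eq_divide])
  moreover have "(\<lambda>n. norm (x - v n)) \<longlonglongrightarrow> norm (x - p)"
    by (intro tendsto_intros p)
  ultimately have le_d: "norm (x - p) \<le> d"
    using v(2) by (intro LIMSEQ_le[of "\<lambda>n. norm (x - v n)"]) (auto intro: less_imp_le)
  have re: "inner (x - p) w = 0" if w: "w \<in> V" for w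
  proof (cases "w = 0")
    case False
    \<comment> \<open>This \<open>t\<close> minimises the distance from \<open>x\<close> to the line
      \<open>p + t *\<^sub>R w\<close>; unless the inner product vanishes, it would beat
      \<open>p\<close>.\<close>
    define t where "t = inner (x - p) w / inner w w"
    have "p + t *\<^sub>R w \<in> V"
      using pV w V(1) by (simp add: scaleR_scaleC complex_vector.subspace_add complex_vector.subspace_scale)
    then have "norm (x - p) \<le> norm (x - (p + t *\<^sub>R w))"
      using d_le le_d by force
    then have "(norm (x - p))\<^sup>2 \<le> (norm ((x - p) - t *\<^sub>R w))\<^sup>2"
      by (simp add: diff_diff_eq)
    also have "\<dots> = (norm (x - p))\<^sup>2 - 2 * t * inner (x - p) w + t * t * inner w w"
      unfolding power2_norm_eq_inner by (simp add: inner_diff inner_commute algebra_simps)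
    also have "t * t * inner w w = t * inner (x - p) w"
      using False by (simp add: t_def)
    finally have "t * inner (x - p) w \<le> 0"
      by simp
    then have "(inner (x - p) w)\<^sup>2 / inner w w \<le> 0"
      by (simp add: t_def power2_eq_square)
    then have "(inner (x - p) w)\<^sup>2 \<le> 0"
      using False by (simp add: pos_divide_le_eq)
    then show ?thesis
      by simp
  qed simp
  have "cinner (x - p) w = 0" if w: "w \<in> V" for w
  proof -
    have "Re (cinner (x - p) w) = 0"
      using re[OF w] by (simp add: inner_eq_Re_cinner)
    \<comment> \<open>The real statement applied to \<open>\<i> *\<^sub>C w\<close> yields the
      imaginary part.\<close>
    moreover have "\<i> *\<^sub>C w \<in> V"
      using w V(1) complex_vector.subspace_scale by blast
    then have "Im (cinner (x - p) w) = 0"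
      using re[of "\<i> *\<^sub>C w"] by (simp add: inner_eq_Re_cinner cinner_scaleC_right)
    ultimately show ?thesis
      by (simp add: complex_eq_iff)
  qed
  with pV show ?thesis
    by blast
qed

text \<open>Meaningful under \<open>closed_csubspace\<close>, where
  \<open>orthogonal_decomposition\<close> gives existence and \<open>orth_proj_eqI\<close>
  uniqueness.\<close>

definition orth_proj :: "'a::complex_hilbert set \<Rightarrow> 'a \<Rightarrow> 'a"
  where "orth_proj V x = (SOME p. p \<in> V \<and> (\<forall>v\<in>V. cinner (x - p) v = 0))"

locale closed_csubspace =
  fixes V :: "'a::complex_hilbert set"
  assumes subspace: "complex_vector.subspace V" and closed: "closed V"
begin

lemma orth_proj_in: "orth_proj V x \<in> V"
  and cinner_orth_proj: "v \<in> V \<Longrightarrow> cinner (x - orth_proj V x) v = 0"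
  using someI_ex[OF orthogonal_decomposition[OF subspace closed, of x, unfolded Bex_def]]
  unfolding orth_proj_def by auto

lemma orth_proj_eqI:
  assumes "p \<in> V" "\<And>v. v \<in> V \<Longrightarrow> cinner (x - p) v = 0"
  shows "orth_proj V x = p"
proof -
  let ?q = "orth_proj V x"
  have qp: "p - ?q \<in> V"
    using assms(1) orth_proj_in subspace complex_vector.subspace_diff by blast
  have "cinner (p - ?q) (p - ?q) = cinner (x - ?q) (p - ?q) - cinner (x - p) (p - ?q)"
    by (simp flip: cinner_diff_left)
  also have "\<dots> = 0"
    using qp assms(2) cinner_orth_proj by simp
  finally show ?thesis
    by (simp add: cinner_self)
qed

lemma orth_proj_id: "x \<in> V \<Longrightarrow> orth_proj V x = x"
  by (rule orth_proj_eqI) auto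

lemma orth_proj_eq_0: "(\<And>v. v \<in> V \<Longrightarrow> cinner x v = 0) \<Longrightarrow> orth_proj V x = 0"
  by (rule orth_proj_eqI) (auto simp: complex_vector.subspace_0 subspace)

lemma norm_orth_proj_le: "norm (orth_proj V x) \<le> norm x"
proof (cases "orth_proj V x = 0")
  case False
  let ?p = "orth_proj V x"
  have "cinner (x - ?p) ?p = 0"
    by (simp add: cinner_orth_proj orth_proj_in)
  then have "cmod (cinner ?p ?p) = cmod (cinner x ?p)"
    by (simp add: cinner_diff_left)
  also have "\<dots> \<le> norm x * norm ?p"
    by (rule cinner_norm_le)
  finally have "norm ?p * norm ?p \<le> norm x * norm ?p"
    by (simp add: cinner_self power2_eq_square norm_mult)
  then show ?thesis
    using False by simp
qed simp

lemma bounded_clinear_orth_proj: "bounded_clinear (orth_proj V)"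
proof (rule bounded_clinearI)
  show "orth_proj V (x + y) = orth_proj V x + orth_proj V y" for x y
  proof (rule orth_proj_eqI)
    have "x + y - (orth_proj V x + orth_proj V y) = (x - orth_proj V x) + (y - orth_proj V y)"
      by simp
    then show "cinner (x + y - (orth_proj V x + orth_proj V y)) v = 0" if "v \<in> V" for v
      using that by (simp only: cinner_add_left cinner_orth_proj add_0)
  qed (simp add: complex_vector.subspace_add orth_proj_in subspace)
  show "orth_proj V (c *\<^sub>C x) = c *\<^sub>C orth_proj V x" for c x
  proof (rule orth_proj_eqI)
    show "cinner (c *\<^sub>C x - c *\<^sub>C orth_proj V x) v = 0" if "v \<in> V" for v
      using cinner_orth_proj[OF that, of x]
      by (simp add: cinner_diff_left cinner_scaleC_left)
  qed (simp add: complex_vector.subspace_scale orth_proj_in subspace)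
  show "norm (orth_proj V x) \<le> norm x * 1" for x
    by (simp add: norm_orth_proj_le)
qed

end

text \<open>If \<open>f\<close> is nonzero, some \<open>e\<close> orthogonal to its kernel has
  \<open>f e \<noteq> 0\<close>. Then \<open>x - (f x / f e) *\<^sub>C e\<close> lies in the kernel
  for every \<open>x\<close>, and pairing it with \<open>e\<close> shows which multiple of
  \<open>e\<close> represents \<open>f\<close>.\<close>

lemma riesz_representation:
  fixes f :: "'a::complex_hilbert \<Rightarrow> complex"
  assumes "bounded_clinear f"
  shows "\<exists>a. \<forall>x. f x = cinner x a"
proof (cases "\<exists>u. f u \<noteq> 0")
  case True
  then obtain u where u: "f u \<noteq> 0"
    by blast
  interpret closed_csubspace "{x. f x = 0}"
  proof
    show "complex_vector.subspace {x. f x = 0}"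
      using assms by (auto simp: complex_vector.subspace_def bounded_clinear_zero
          bounded_clinear_add bounded_clinear_scaleC scaleC_complex_def)
    have "continuous_on UNIV f"
      using assms bounded_clinear_imp_bounded_linear linear_continuous_on by blast
    then show "closed {x. f x = 0}"
      by (simp add: closed_Collect_eq)
  qed
  define e where "e = u - orth_proj {x. f x = 0} u"
  have fe: "f e \<noteq> 0"
    using u orth_proj_in[of u] by (simp add: e_def bounded_clinear_diff[OF assms])
  then have e0: "e \<noteq> 0"
    using bounded_clinear_zero[OF assms] by auto
  have "f x = cinner x (cnj (f e / cinner e e) *\<^sub>C e)" for x
  proof -
    have "x - (f x / f e) *\<^sub>C e \<in> {x. f x = 0}"
      using fe by (simp add: bounded_clinear_diff[OF assms] bounded_clinear_scaleC[OF assms]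
          scaleC_complex_def)
    then have "cinner e (x - (f x / f e) *\<^sub>C e) = 0"
      unfolding e_def by (rule cinner_orth_proj)
    then have "cinner (x - (f x / f e) *\<^sub>C e) e = 0"
      by (metis cinner_commute complex_cnj_zero)
    then have "cinner x e = f x / f e * cinner e e"
      by (simp add: cinner_diff_left cinner_scaleC_left)
    moreover have "cinner e e \<noteq> 0"
      using e0 by (simp add: cinner_self)
    ultimately show ?thesis
      using fe by (simp add: cinner_scaleC_right)
  qed
  then show ?thesis
    by blast
next
  case False
  then show ?thesis
    by (intro exI[of _ 0]) simp
qed

text \<open>Justifies the definite description in \<open>cadjoint\<close>: Riesz representation
  supplies a value for each \<open>y\<close>, and nondegeneracy of the inner product makes it
  unique.\<close>

lemma cinner_cadjoint:
  fixes S :: "'a::complex_hilbert \<Rightarrow> 'b::complex_inner"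
  assumes "bounded_clinear S"
  shows "cinner (S x) y = cinner x (cadjoint S y)"
proof -
  have "\<exists>a. \<forall>x. cinner (S x) y = cinner x a" for y
  proof (rule riesz_representation)
    have "bounded_linear (\<lambda>x. cinner (S x) y)"
      using bounded_linear_compose[OF bounded_bilinear.bounded_linear_left[OF bounded_bilinear_cinner]]
        assms bounded_clinear_imp_bounded_linear by blast
    then show "bounded_clinear (\<lambda>x. cinner (S x) y)"
      using assms by (simp add: bounded_clinear_def cinner_scaleC_left scaleC_complex_def)
  qed
  then obtain A where A: "\<forall>x y. cinner (S x) y = cinner x (A y)"
    by metis
  have "A' = A" if "\<forall>x y. cinner (S x) y = cinner x (A' y)" for A'
  proof
    fix y
    have "cinner x (A' y - A y) = 0" for x
      using A that by (simp add: cinner_diff_right)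
    then have "A' y - A y = 0"
      by (rule cinner_eq_zero_all)
    then show "A' y = A y"
      by simp
  qed
  with A have "\<forall>x y. cinner (S x) y = cinner x (cadjoint S y)"
    unfolding cadjoint_def by (rule theI)
  then show ?thesis
    by blast
qed

lemma null_space_cadjoint:
  fixes S :: "'a::complex_hilbert \<Rightarrow> 'b::complex_inner"
  assumes "bounded_clinear S"
  shows "null_space (cadjoint S) = {y. \<forall>x. cinner (S x) y = 0}"
proof -
  have "cadjoint S y = 0 \<longleftrightarrow> (\<forall>x. cinner (S x) y = 0)" for y
    by (metis cinner_cadjoint[OF assms, symmetric] cinner_eq_zero_all cinner_zero_right)
  then show ?thesis
    by (simp add: null_space_def)
qed

section \<open>Removing the large spectral values of a compact operator\<close>

text \<open>Weaker than the usual notion: only \<open>F\<close>, not its orthogonal complement, is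
  invariant. Compactness of the projection encodes finite dimension in the form needed later, namely
  that compressing \<open>F\<close> away is a compact perturbation.\<close>

definition reducing_subspace :: "('a::complex_hilbert \<Rightarrow> 'a) \<Rightarrow> ('a \<Rightarrow> 'a) \<Rightarrow> 'a set \<Rightarrow> bool"
  where "reducing_subspace K T F \<longleftrightarrow> closed_csubspace F \<and> (\<forall>x\<in>F. K x \<in> F \<and> T x \<in> F) \<and>
    compact_operator (orth_proj F)"

lemma reducing_subspace_zero:
  assumes "bounded_clinear K" "bounded_clinear T"
  shows "reducing_subspace K T {0}"
proof -
  have c: "closed_csubspace {0::'a}"
    by unfold_locales (simp_all add: complex_vector.subspace_def)
  then have "orth_proj {0} = (\<lambda>x. 0::'a)"
    using closed_csubspace.orth_proj_in by fastforce
  then show ?thesis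
    using c assms by (simp add: reducing_subspace_def compact_operator_zero bounded_clinear_zero)
qed

text \<open>The projection \<open>D\<close> onto the part of \<open>F'\<close> orthogonal to
  \<open>F\<close> satisfies \<open>l D = (1 - P) K D\<close>, with \<open>P\<close> the projection
  onto \<open>F\<close>, because \<open>l - K\<close> maps \<open>F'\<close> into \<open>F\<close>.
  As \<open>l\<close> is nonzero, \<open>D\<close> inherits compactness from \<open>K\<close>, and
  the projection onto \<open>F'\<close> is \<open>D + P\<close>.\<close>

lemma reducing_subspace_preimage:
  fixes K T :: "'a::complex_hilbert \<Rightarrow> 'a"
  assumes K: "compact_operator K" and T: "bounded_clinear T" and comm: "\<And>x. K (T x) = T (K x)"
    and F: "reducing_subspace K T F" and l: "l \<noteq> 0"
  defines "F' \<equiv> {y. l *\<^sub>C y - K y \<in> F}"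
  shows "reducing_subspace K T F'" "F \<subseteq> F'"
proof -
  let ?P = "orth_proj F" and ?P' = "orth_proj F'"
  have Kc: "bounded_clinear K"
    using K compact_operator_clinear by blast
  interpret F: closed_csubspace F
    using F by (simp add: reducing_subspace_def)
  have sub: "complex_vector.subspace F"
    by (rule F.subspace)
  have KF: "K x \<in> F" and TF: "T x \<in> F" if "x \<in> F" for x
    using F that by (auto simp: reducing_subspace_def)
  have lK: "bounded_clinear (\<lambda>y. l *\<^sub>C y - K y)"
    by (intro bounded_clinear_minus bounded_clinear_scaled bounded_clinear_id Kc)
  interpret F': closed_csubspace F'
  proof
    have "complex_vector.subspace ((\<lambda>y. l *\<^sub>C y - K y) -` F)"
      using sub bounded_clinear_zero[OF lK] bounded_clinear_add[OF lK] bounded_clinear_scaleC[OF lK]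
      by (simp add: complex_vector.subspace_def)
    then show "complex_vector.subspace F'"
      by (simp add: F'_def vimage_def)
    have "closed ((\<lambda>y. l *\<^sub>C y - K y) -` F)"
      using lK bounded_clinear_imp_bounded_linear linear_continuous_on F.closed
      by (intro closed_vimage) blast+
    then show "closed F'"
      by (simp add: F'_def vimage_def)
  qed
  show FF': "F \<subseteq> F'"
    using KF sub by (auto simp: F'_def complex_vector.subspace_diff complex_vector.subspace_scale)
  define D where "D = (\<lambda>x. ?P' x - ?P x)"
  have D: "D x = inverse l *\<^sub>C (K (D x) - ?P (K (D x)))" for x
  proof -
    have "D x \<in> F'"
      using FF' F.orth_proj_in F'.orth_proj_in F'.subspace
      by (auto simp: D_def intro!: complex_vector.subspace_diff)
    then have "?P (l *\<^sub>C D x - K (D x)) = l *\<^sub>C D x - K (D x)"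
      by (simp add: F'_def F.orth_proj_id)
    moreover have "?P (D x) = 0"
    proof (rule F.orth_proj_eq_0)
      fix v assume v: "v \<in> F"
      have "cinner (D x) v = cinner (x - ?P x) v - cinner (x - ?P' x) v"
        by (simp add: D_def flip: cinner_diff_left)
      then show "cinner (D x) v = 0"
        using v FF' F.cinner_orth_proj[OF v] F'.cinner_orth_proj[of v] by auto
    qed
    ultimately have "l *\<^sub>C D x = K (D x) - ?P (K (D x))"
      by (simp add: bounded_clinear_diff[OF F.bounded_clinear_orth_proj]
          bounded_clinear_scaleC[OF F.bounded_clinear_orth_proj] algebra_simps)
    then show ?thesis
      using l by (metis complex_vector.scale_left_imp_eq complex_vector.scale_one scaleC_scaleC left_inverse)
  qed
  have Dc: "bounded_clinear D"
    unfolding D_def by (intro bounded_clinear_minus F.bounded_clinear_orth_proj F'.bounded_clinear_orth_proj)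
  have KD: "compact_operator (\<lambda>x. K (D x))"
    by (rule compact_operator_right[OF K Dc])
  have "compact_operator (\<lambda>x. inverse l *\<^sub>C (K (D x) - ?P (K (D x))))"
    by (rule compact_operator_scaled[OF compact_operator_minus[OF KD
          compact_operator_left[OF F.bounded_clinear_orth_proj KD]]])
  then have "compact_operator D"
    using D by simp
  moreover have "compact_operator ?P"
    using F by (simp add: reducing_subspace_def)
  ultimately have "compact_operator (\<lambda>x. D x + ?P x)"
    by (rule compact_operator_plus)
  then have "compact_operator ?P'"
    by (simp add: D_def)
  moreover have "K x \<in> F'" "T x \<in> F'" if "x \<in> F'" for x
  proof -
    have x: "l *\<^sub>C x - K x \<in> F"
      using that by (simp add: F'_def)
    have "l *\<^sub>C K x - K (K x) = K (l *\<^sub>C x - K x)"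
      by (simp add: bounded_clinear_diff[OF Kc] bounded_clinear_scaleC[OF Kc])
    then show "K x \<in> F'"
      using KF[OF x] by (simp add: F'_def)
    have "l *\<^sub>C T x - K (T x) = T (l *\<^sub>C x - K x)"
      by (simp add: bounded_clinear_diff[OF T] bounded_clinear_scaleC[OF T] comm)
    then show "T x \<in> F'"
      using TF[OF x] by (simp add: F'_def)
  qed
  ultimately show "reducing_subspace K T F'"
    unfolding reducing_subspace_def using F'.closed_csubspace_axioms by blast
qed

text \<open>Otherwise the preimages of \<^term>\<open>{0}\<close> under suitable \<open>l - K\<close> form a strictly increasing chain,
  and unit vectors orthogonal to the preceding members have uniformly separated images under \<open>K\<close>.\<close>

lemma exists_reducing_subspace:
  fixes K T :: "'a::complex_hilbert \<Rightarrow> 'a"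
  assumes K: "compact_operator K" and T: "bounded_clinear T" and comm: "\<And>x. K (T x) = T (K x)"
    and r: "r > 0"
  shows "\<exists>F. reducing_subspace K T F \<and>
    (\<forall>l x. cmod l \<ge> r \<longrightarrow> (\<forall>v\<in>F. cinner x v = 0) \<longrightarrow> l *\<^sub>C x - K x \<in> F \<longrightarrow> x = 0)"
proof (rule ccontr)
  assume neg: "\<not> ?thesis"
  have Kc: "bounded_clinear K"
    using K compact_operator_clinear by blast
  have "\<exists>l x. cmod l \<ge> r \<and> (\<forall>v\<in>F. cinner x v = 0) \<and> l *\<^sub>C x - K x \<in> F \<and> norm x = 1"
    if F: "reducing_subspace K T F" for F
  proof -
    obtain l x where x: "cmod l \<ge> r" "\<forall>v\<in>F. cinner x v = 0" "l *\<^sub>C x - K x \<in> F" "x \<noteq> 0"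
      using neg F by blast
    define c where "c = complex_of_real (1 / norm x)"
    have "l *\<^sub>C (c *\<^sub>C x) - K (c *\<^sub>C x) = c *\<^sub>C (l *\<^sub>C x - K x)"
      by (simp add: bounded_clinear_scaleC[OF Kc] complex_vector.scale_right_diff_distrib
          scaleC_scaleC mult.commute)
    also have "\<dots> \<in> F"
      using x(3) F by (simp add: reducing_subspace_def closed_csubspace_def complex_vector.subspace_scale)
    finally have "l *\<^sub>C (c *\<^sub>C x) - K (c *\<^sub>C x) \<in> F" .
    moreover have "norm (c *\<^sub>C x) = 1"
      using x(4) by (simp add: norm_scaleC c_def norm_divide)
    moreover have "\<forall>v\<in>F. cinner (c *\<^sub>C x) v = 0"
      using x(2) by (simp add: cinner_scaleC_left)
    ultimately show ?thesis
      using x(1) by blast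
  qed
  then obtain lam xi where lx: "\<And>F. reducing_subspace K T F \<Longrightarrow> cmod (lam F) \<ge> r"
      "\<And>F v. reducing_subspace K T F \<Longrightarrow> v \<in> F \<Longrightarrow> cinner (xi F) v = 0"
      "\<And>F. reducing_subspace K T F \<Longrightarrow> lam F *\<^sub>C xi F - K (xi F) \<in> F"
      "\<And>F. reducing_subspace K T F \<Longrightarrow> norm (xi F) = 1"
    by metis
  \<comment> \<open>Each member of the chain is the preimage of the preceding one, with the value
    \<open>lam\<close> that witnesses its failure; \<open>xi (F n)\<close> is then a unit vector of
    \<open>F (Suc n)\<close> orthogonal to \<open>F n\<close>.\<close>
  define F where "F n = ((\<lambda>F. {y. lam F *\<^sub>C y - K y \<in> F}) ^^ n) {0}" for n
  have F_Suc: "F (Suc n) = {y. lam (F n) *\<^sub>C y - K y \<in> F n}" for n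
    by (simp add: F_def)
  have red: "reducing_subspace K T (F n)" for n
  proof (induction n)
    case 0
    then show ?case
      using reducing_subspace_zero[OF Kc T] by (simp add: F_def)
  next
    case (Suc n)
    have "lam (F n) \<noteq> 0"
      using lx(1)[OF Suc] r by auto
    then show ?case
      unfolding F_Suc using reducing_subspace_preimage(1)[OF K T comm Suc] by blast
  qed
  have "F n \<subseteq> F (Suc n)" for n
  proof -
    have "lam (F n) \<noteq> 0"
      using lx(1)[OF red[of n]] r by auto
    then show ?thesis
      unfolding F_Suc using reducing_subspace_preimage(2)[OF K T comm red] by blast
  qed
  then have mono: "F m \<subseteq> F n" if "m \<le> n" for m n
    using that by (rule lift_Suc_mono_le)
  define x where "x n = xi (F n)" for n
  \<comment> \<open>Modulo \<open>F n\<close>, \<open>K (x n)\<close> equals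
    \<open>lam (F n) *\<^sub>C x n\<close> and \<open>K (x m)\<close> vanishes. Pairing the
    difference with \<open>x n\<close>, which is orthogonal to \<open>F n\<close>, leaves a number
    of modulus at least \<open>r\<close>.\<close>
  have sep: "r \<le> norm (K (x n) - K (x m))" if "m < n" for m n
  proof -
    have cs: "complex_vector.subspace (F n)"
      using red by (simp add: reducing_subspace_def closed_csubspace_def)
    have "x m \<in> F (Suc m)"
      using lx(3)[OF red[of m]] by (simp add: F_Suc x_def)
    then have "K (x m) \<in> F n"
      using mono[of "Suc m" n] that red[of n] by (auto simp: reducing_subspace_def)
    then have "(lam (F n) *\<^sub>C x n - K (x n)) + K (x m) \<in> F n"
      using lx(3)[OF red[of n]] cs by (simp add: x_def complex_vector.subspace_add)
    then have "cinner (x n) ((lam (F n) *\<^sub>C x n - K (x n)) + K (x m)) = 0"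
      using lx(2)[OF red[of n]] by (simp add: x_def)
    moreover have "cinner (x n) (x n) = 1"
      using lx(4)[OF red[of n]] by (simp add: cinner_self x_def)
    ultimately have "cinner (x n) (K (x n) - K (x m)) = cnj (lam (F n))"
      by (simp add: cinner_add_right cinner_diff_right cinner_scaleC_right algebra_simps eq_diff_eq)
    then have "cmod (lam (F n)) \<le> norm (x n) * norm (K (x n) - K (x m))"
      by (metis cinner_norm_le complex_mod_cnj)
    then show ?thesis
      using lx(1)[OF red[of n]] lx(4)[OF red[of n]] by (simp add: x_def)
  qed
  obtain l s where s: "strict_mono s" "(\<lambda>n. K (x (s n))) \<longlonglongrightarrow> l"
    using compact_operator_convergent_subseq[OF K, of x] lx(4)[OF red] unfolding x_def by fastforce
  then have "Cauchy (\<lambda>n. K (x (s n)))"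
    by (blast intro: LIMSEQ_imp_Cauchy)
  then obtain N where "\<And>m n. m \<ge> N \<Longrightarrow> n \<ge> N \<Longrightarrow> norm (K (x (s m)) - K (x (s n))) < r"
    using CauchyD[of "\<lambda>n. K (x (s n))" r] r by blast
  then have "norm (K (x (s (Suc N))) - K (x (s N))) < r"
    by simp
  moreover have "s N < s (Suc N)"
    using s(1) by (simp add: strict_mono_Suc_iff)
  ultimately show False
    using sep by force
qed

section \<open>Growth of powers\<close>

text \<open>With \<open>z\<close> the reciprocal of an eigenvalue, the injectivity assumption says
  that all eigenvalues of \<open>L\<close> have modulus below \<open>1 / R\<close>. This variable
  puts the identity at \<open>z = 0\<close>, inside the disc.\<close>

locale injective_pencil =
  fixes L :: "'a::complex_hilbert \<Rightarrow> 'a" and R :: real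
  assumes compact_op: "compact_operator L" and R_pos: "R > 0"
    and inj: "cmod z \<le> R \<Longrightarrow> x = z *\<^sub>C L x \<Longrightarrow> x = 0"
begin

section \<open>The pencil \<open>1 - z L\<close> on a closed disc: lower bound and
  surjectivity\<close>

lemma clinear: "bounded_clinear L"
  using compact_op compact_operator_clinear by blast

lemma bounded_clinear_pencil: "bounded_clinear (\<lambda>x. x - z *\<^sub>C L x)"
  by (intro bounded_clinear_minus bounded_clinear_scaled bounded_clinear_id clinear)

text \<open>Normalised counterexamples have a subsequence along which both \<open>z n\<close> and
  \<open>L (x n)\<close> converge. Since \<open>x n - z n *\<^sub>C L (x n)\<close> tends to 0, the
  unit vectors converge too, and their limit violates injectivity.\<close>

lemma bounded_below:
  "\<exists>c>0. \<forall>z x. cmod z \<le> R \<longrightarrow> c * norm x \<le> norm (x - z *\<^sub>C L x)"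
proof (rule ccontr)
  assume neg: "\<not> ?thesis"
  have "\<exists>z x. cmod z \<le> R \<and> norm x = 1 \<and> norm (x - z *\<^sub>C L x) < 1 / Suc n" for n
  proof -
    have "1 / real (Suc n) > 0"
      by simp
    then obtain z x where zx: "cmod z \<le> R" "norm (x - z *\<^sub>C L x) < 1 / Suc n * norm x"
      using neg by (metis linorder_not_less)
    then have x0: "norm x > 0"
      by (metis mult_zero_right norm_ge_zero not_less zero_less_norm_iff norm_zero)
    let ?c = "complex_of_real (1 / norm x)"
    have "?c *\<^sub>C x - z *\<^sub>C L (?c *\<^sub>C x) = ?c *\<^sub>C (x - z *\<^sub>C L x)"
      using bounded_clinear_scaleC[OF bounded_clinear_pencil] .
    then have "norm (?c *\<^sub>C x - z *\<^sub>C L (?c *\<^sub>C x)) = norm (x - z *\<^sub>C L x) / norm x"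
      by (simp add: norm_scaleC norm_divide)
    also have "\<dots> < 1 / Suc n"
      using zx(2) x0 by (simp add: pos_divide_less_eq)
    finally have "norm (?c *\<^sub>C x - z *\<^sub>C L (?c *\<^sub>C x)) < 1 / Suc n" .
    moreover have "norm (?c *\<^sub>C x) = 1"
      using x0 by (simp add: norm_scaleC norm_divide)
    ultimately show ?thesis
      using zx(1) by blast
  qed
  then obtain z x where zx: "\<And>n. cmod (z n) \<le> R" "\<And>n. norm (x n) = 1"
      "\<And>n. norm (x n - z n *\<^sub>C L (x n)) < 1 / Suc n"
    by metis
  obtain s y where s: "strict_mono s" "(\<lambda>n. L (x (s n))) \<longlonglongrightarrow> y"
    using compact_operator_convergent_subseq[OF compact_op, of x] zx(2) by fastforce
  have "\<forall>n. z (s n) \<in> cball 0 R"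
    using zx(1) by simp
  then have "\<exists>w\<in>cball 0 R. \<exists>t. strict_mono t \<and> ((\<lambda>n. z (s n)) \<circ> t) \<longlonglongrightarrow> w"
    using compact_cball[of "0::complex" R, unfolded compact_def, THEN spec, of "\<lambda>n. z (s n)"] by blast
  then obtain w t where t: "cmod w \<le> R" "strict_mono t" "(\<lambda>n. z (s (t n))) \<longlonglongrightarrow> w"
    by (auto simp: o_def)
  have y: "(\<lambda>n. L (x (s (t n)))) \<longlonglongrightarrow> y"
    using LIMSEQ_subseq_LIMSEQ[OF s(2) t(2)] by (simp add: o_def)
  have "(\<lambda>n. x n - z n *\<^sub>C L (x n)) \<longlonglongrightarrow> 0"
  proof (rule Lim_null_comparison)
    show "(\<lambda>n. 1 / real (Suc n)) \<longlonglongrightarrow> 0"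
      using LIMSEQ_inverse_real_of_nat by (simp add: inverse_eq_divide)
  qed (use zx(3) in \<open>auto intro!: always_eventually less_imp_le\<close>)
  then have "(\<lambda>n. x (s (t n)) - z (s (t n)) *\<^sub>C L (x (s (t n)))) \<longlonglongrightarrow> 0"
    using LIMSEQ_subseq_LIMSEQ[OF _ strict_mono_o[OF s(1) t(2)]] by (fastforce simp: o_def)
  moreover have "(\<lambda>n. z (s (t n)) *\<^sub>C L (x (s (t n)))) \<longlonglongrightarrow> w *\<^sub>C y"
    by (rule bounded_bilinear.tendsto[OF bounded_bilinear_scaleC t(3) y])
  ultimately have "(\<lambda>n. (x (s (t n)) - z (s (t n)) *\<^sub>C L (x (s (t n)))) + z (s (t n)) *\<^sub>C L (x (s (t n))))
      \<longlonglongrightarrow> 0 + w *\<^sub>C y"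
    by (rule tendsto_add)
  then have lim: "(\<lambda>n. x (s (t n))) \<longlonglongrightarrow> w *\<^sub>C y"
    by simp
  then have "(\<lambda>n. L (x (s (t n)))) \<longlonglongrightarrow> L (w *\<^sub>C y)"
    using bounded_linear.tendsto[OF bounded_clinear_imp_bounded_linear[OF clinear]] by blast
  with y have "y = L (w *\<^sub>C y)"
    using LIMSEQ_unique by blast
  then have "w *\<^sub>C y = 0"
    using inj[OF t(1), of "w *\<^sub>C y"] by simp
  moreover have "norm (w *\<^sub>C y) = 1"
    using tendsto_norm[OF lim] LIMSEQ_unique[OF tendsto_const, of 1] unfolding zx(2) by metis
  ultimately show False
    by (metis norm_zero zero_neq_one)
qed

text \<open>One constant for the whole disc; its reciprocal bounds every resolvent there.\<close>

definition below :: real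
  where "below = (SOME c. c > 0 \<and> (\<forall>z x. cmod z \<le> R \<longrightarrow> c * norm x \<le> norm (x - z *\<^sub>C L x)))"

lemma below_pos: "below > 0"
  and below_le: "cmod z \<le> R \<Longrightarrow> below * norm x \<le> norm (x - z *\<^sub>C L x)"
  using someI_ex[OF bounded_below] unfolding below_def by auto

lemma pencil_eq_iff:
  assumes "cmod z \<le> R"
  shows "x - z *\<^sub>C L x = y - z *\<^sub>C L y \<longleftrightarrow> x = y"
proof
  assume "x - z *\<^sub>C L x = y - z *\<^sub>C L y"
  then have "(x - y) - z *\<^sub>C L (x - y) = 0"
    using bounded_clinear_diff[OF bounded_clinear_pencil[of z], of x y] by simp
  then show "x = y"
    using inj[OF assms, of "x - y"] by simp
qed simp

text \<open>With \<open>G\<close> a right inverse of the pencil at \<open>z\<close>, solving at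
  \<open>w\<close> means finding a fixed point of
  \<open>x \<mapsto> G (y + (w - z) *\<^sub>C L x)\<close>. The lower bound makes \<open>G\<close>
  Lipschitz with constant \<open>1 / below\<close>, so this map is a contraction.\<close>

lemma surj_pencil_near:
  assumes z: "cmod z \<le> R" "surj (\<lambda>x. x - z *\<^sub>C L x)"
    and b: "\<And>x. norm (L x) \<le> norm x * b" and w: "cmod (w - z) * b < below" and b0: "b > 0"
  shows "surj (\<lambda>x. x - w *\<^sub>C L x)"
  unfolding surj_def
proof
  fix y
  define G where "G = inv (\<lambda>x. x - z *\<^sub>C L x)"
  have G: "G u - z *\<^sub>C L (G u) = u" for u
    using surj_f_inv_f[OF z(2)] by (simp add: G_def)
  have Gdiff: "below * norm (G u - G v) \<le> norm (u - v)" for u v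
    using below_le[OF z(1), of "G u - G v"] G[of u] G[of v]
      bounded_clinear_diff[OF bounded_clinear_pencil[of z], of "G u" "G v"] by simp
  have "\<exists>!x. G (y + (w - z) *\<^sub>C L x) = x"
  proof (rule banach_fix_type[where c = "cmod (w - z) * b / below"])
    show "\<forall>x x'. dist (G (y + (w - z) *\<^sub>C L x)) (G (y + (w - z) *\<^sub>C L x'))
        \<le> cmod (w - z) * b / below * dist x x'"
    proof (intro allI)
      fix x x'
      have "below * norm (G (y + (w - z) *\<^sub>C L x) - G (y + (w - z) *\<^sub>C L x'))
          \<le> norm ((w - z) *\<^sub>C L (x - x'))"
        using Gdiff[of "y + (w - z) *\<^sub>C L x" "y + (w - z) *\<^sub>C L x'"]
        by (simp add: bounded_clinear_diff[OF clinear] complex_vector.scale_right_diff_distrib)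
      also have "\<dots> \<le> cmod (w - z) * (norm (x - x') * b)"
        unfolding norm_scaleC by (intro mult_left_mono b) simp
      finally show "dist (G (y + (w - z) *\<^sub>C L x)) (G (y + (w - z) *\<^sub>C L x'))
          \<le> cmod (w - z) * b / below * dist x x'"
        using below_pos by (simp add: dist_norm field_simps)
    qed
  qed (use below_pos w b0 in auto)
  then obtain x where "G (y + (w - z) *\<^sub>C L x) = x"
    by blast
  with G[of "y + (w - z) *\<^sub>C L x"] have "x - z *\<^sub>C L x = y + (w - z) *\<^sub>C L x"
    by simp
  then have "y = x - w *\<^sub>C L x"
    by (simp add: complex_vector.scale_left_diff_distrib algebra_simps)
  then show "\<exists>x. y = x - w *\<^sub>C L x"
    by blast
qed

text \<open>Continuation from \<open>z = 0\<close> along the ray through \<open>z\<close> in steps of length bounded by the uniform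
  lower bound.\<close>

lemma surj_pencil:
  assumes z: "cmod z \<le> R"
  shows "surj (\<lambda>x. x - z *\<^sub>C L x)"
proof -
  obtain b where b: "b > 0" "\<And>x. norm (L x) \<le> norm x * b"
    using bounded_linear.pos_bounded bounded_clinear_imp_bounded_linear clinear by blast
  \<comment> \<open>Each of the \<open>m\<close> steps has length at most \<open>R / m\<close>, and
    \<open>R / m * b < below\<close> is what \<open>surj_pencil_near\<close> demands.\<close>
  obtain m :: nat where m: "real m > R * b / below"
    using reals_Archimedean2 by blast
  have m0: "real m > 0"
    using m R_pos b(1) below_pos by (smt (verit) divide_nonneg_pos mult_nonneg_nonneg)
  have "surj (\<lambda>x. x - (of_real (k / m) * z) *\<^sub>C L x)" if "k \<le> m" for k :: nat
    using that
  proof (induction k)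
    case 0
    then show ?case
      by simp
  next
    case (Suc k)
    have "cmod (of_real (k / m)) \<le> 1"
      unfolding norm_of_real using Suc.prems m0 by simp
    then have "cmod (of_real (k / m) * z) \<le> 1 * R"
      unfolding norm_mult using z by (rule mult_mono) auto
    moreover have "cmod (of_real (Suc k / m) * z - of_real (k / m) * z) = cmod z / m"
    proof -
      have "of_real (Suc k / m) * z - of_real (k / m) * z = of_real (1 / m) * z"
        by (simp add: add_divide_distrib distrib_right)
      then show ?thesis
        by (simp add: norm_mult norm_divide)
    qed
    moreover have "cmod z / m * b < below"
    proof -
      have "cmod z * b \<le> R * b"
        using z b(1) by (intro mult_right_mono) auto
      also have "\<dots> < below * m"
        using m below_pos by (simp add: field_simps)
      finally show ?thesis
        using m0 by (simp add: field_simps)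
    qed
    ultimately show ?case
      using surj_pencil_near[OF _ Suc.IH b(2) _ b(1)] Suc.prems by simp
  qed
  from this[of m] show ?thesis
    using m0 by simp
qed

section \<open>The resolvent \<open>(1 - z L)\<close> to the power -1: identities and
  analyticity\<close>

definition resolvent :: "complex \<Rightarrow> 'a \<Rightarrow> 'a"
  where "resolvent z = inv (\<lambda>x. x - z *\<^sub>C L x)"

lemma pencil_resolvent:
  "cmod z \<le> R \<Longrightarrow> resolvent z x - z *\<^sub>C L (resolvent z x) = x"
  using surj_f_inv_f[OF surj_pencil] by (simp add: resolvent_def)

lemma resolvent_eqI: "cmod z \<le> R \<Longrightarrow> u - z *\<^sub>C L u = x \<Longrightarrow> resolvent z x = u"
  using pencil_resolvent pencil_eq_iff by metis

lemma norm_resolvent_le: "cmod z \<le> R \<Longrightarrow> norm (resolvent z x) \<le> norm x / below"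
  using below_le[of z "resolvent z x"] pencil_resolvent[of z x] below_pos
  by (simp add: field_simps)

lemma resolvent_0 [simp]: "resolvent 0 x = x"
  using R_pos by (intro resolvent_eqI) auto

text \<open>The resolvent commutes with \<open>L\<close>. For nonzero \<open>z\<close> this trades a
  factor \<open>L\<close> for a division by \<open>z\<close>, the gain exploited on the boundary
  circle.\<close>

lemma resolvent_image: "cmod z \<le> R \<Longrightarrow> z *\<^sub>C resolvent z (L x) = resolvent z x - x"
proof -
  assume z: "cmod z \<le> R"
  have "resolvent z (L x) = L (resolvent z x)"
  proof (rule resolvent_eqI[OF z])
    have "L (resolvent z x) - z *\<^sub>C L (L (resolvent z x)) = L (resolvent z x - z *\<^sub>C L (resolvent z x))"
      by (simp add: bounded_clinear_diff[OF clinear] bounded_clinear_scaleC[OF clinear])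
    then show "L (resolvent z x) - z *\<^sub>C L (L (resolvent z x)) = L x"
      using pencil_resolvent[OF z] by simp
  qed
  then show ?thesis
    using pencil_resolvent[OF z, of x] by (simp add: algebra_simps)
qed

text \<open>The first resolvent identity; continuity and complex differentiability in the parameter
  both follow from it.\<close>

lemma resolvent_diff:
  assumes z: "cmod z \<le> R" and w: "cmod w \<le> R"
  shows "resolvent w x - resolvent z x = (w - z) *\<^sub>C resolvent w (L (resolvent z x))"
proof -
  let ?u = "resolvent z x" and ?v = "resolvent w (L (resolvent z x))"
  have "resolvent w x = ?u + (w - z) *\<^sub>C ?v"
  proof (rule resolvent_eqI[OF w])
    have "?u + d *\<^sub>C ?v - w *\<^sub>C L (?u + d *\<^sub>C ?v)
        = ?u - w *\<^sub>C L ?u + d *\<^sub>C (?v - w *\<^sub>C L ?v)" for d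
      by (simp add: bounded_clinear_add[OF clinear] bounded_clinear_scaleC[OF clinear] scaleC_add_right
          complex_vector.scale_right_diff_distrib complex_vector.scale_left_commute[of d])
    then have "?u + (w - z) *\<^sub>C ?v - w *\<^sub>C L (?u + (w - z) *\<^sub>C ?v)
        = ?u - w *\<^sub>C L ?u + (w - z) *\<^sub>C (?v - w *\<^sub>C L ?v)" .
    also have "\<dots> = ?u - z *\<^sub>C L ?u"
      by (simp add: pencil_resolvent[OF w] complex_vector.scale_left_diff_distrib)
    also have "\<dots> = x"
      by (rule pencil_resolvent[OF z])
    finally show "?u + (w - z) *\<^sub>C ?v - w *\<^sub>C L (?u + (w - z) *\<^sub>C ?v) = x" .
  qed
  then show ?thesis
    by simp
qed

lemma tendsto_resolvent:
  assumes z: "cmod z \<le> R"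
  shows "((\<lambda>w. resolvent w x) \<longlongrightarrow> resolvent z x) (at z within cball 0 R)"
proof -
  let ?B = "norm (L (resolvent z x)) / below"
  have "((\<lambda>w. resolvent w x - resolvent z x) \<longlongrightarrow> 0) (at z within cball 0 R)"
  proof (rule Lim_null_comparison)
    show "\<forall>\<^sub>F w in at z within cball 0 R. norm (resolvent w x - resolvent z x) \<le> cmod (w - z) * ?B"
    proof (intro eventually_at_topological[THEN iffD2] exI[of _ UNIV] conjI ballI impI)
      fix w :: complex assume "w \<in> cball 0 R"
      then have w: "cmod w \<le> R"
        by simp
      show "norm (resolvent w x - resolvent z x) \<le> cmod (w - z) * ?B"
        unfolding resolvent_diff[OF z w] norm_scaleC
        by (intro mult_left_mono norm_resolvent_le w) simp
    qed simp_all
    show "((\<lambda>w. cmod (w - z) * ?B) \<longlongrightarrow> 0) (at z within cball 0 R)"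
      by (rule tendsto_eq_intros | simp)+
  qed
  then show ?thesis
    by (simp add: LIM_zero_iff)
qed

text \<open>Dividing \<open>resolvent_diff\<close> by \<open>w - z\<close> exhibits the derivative.
  Working on the closed disc also gives the continuity up to the boundary that the maximum principle
  requires.\<close>

lemma holomorphic_resolvent: "(\<lambda>z. cinner (resolvent z x) y) holomorphic_on cball 0 R"
  unfolding holomorphic_on_def
proof
  fix z :: complex assume "z \<in> cball 0 R"
  then have z: "cmod z \<le> R"
    by simp
  let ?u = "L (resolvent z x)"
  have "((\<lambda>w. cinner (resolvent w ?u) y) \<longlongrightarrow> cinner (resolvent z ?u) y) (at z within cball 0 R)"
    by (intro bounded_bilinear.tendsto[OF bounded_bilinear_cinner] tendsto_resolvent z tendsto_const)
  moreover have "\<forall>\<^sub>F w in at z within cball 0 R. cinner (resolvent w ?u) y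
      = (cinner (resolvent w x) y - cinner (resolvent z x) y) / (w - z)"
  proof (intro eventually_at_topological[THEN iffD2] exI[of _ UNIV] conjI ballI impI)
    fix w :: complex assume "w \<in> cball 0 R" "w \<noteq> z"
    then show "cinner (resolvent w ?u) y = (cinner (resolvent w x) y - cinner (resolvent z x) y) / (w - z)"
      using resolvent_diff[OF z, of w x] by (simp flip: cinner_diff_left add: cinner_scaleC_left)
  qed simp_all
  ultimately have "((\<lambda>w. cinner (resolvent w x) y) has_field_derivative cinner (resolvent z ?u) y)
      (at z within cball 0 R)"
    unfolding has_field_derivative_iff using tendsto_cong by fastforce
  then show "(\<lambda>z. cinner (resolvent z x) y) field_differentiable at z within cball 0 R"
    unfolding field_differentiable_def by blast
qed

text \<open>On the circle of radius \<open>R\<close>, \<open>resolvent_image\<close> writes one more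
  factor \<open>L\<close> as a difference of two terms bounded by induction, divided by
  \<open>w\<close>; this costs the factor \<open>2 / R\<close>. The maximum principle carries the
  bound into the disc.\<close>

lemma cinner_resolvent_power_le:
  "cmod z \<le> R \<Longrightarrow> cmod (cinner (resolvent z ((L ^^ n) x)) y) \<le> (2 / R) ^ n * (norm x * norm y / below)"
proof (induction n arbitrary: z)
  case 0
  have "cmod (cinner (resolvent z x) y) \<le> norm (resolvent z x) * norm y"
    by (rule cinner_norm_le)
  also have "\<dots> \<le> (norm x / below) * norm y"
    using norm_resolvent_le[OF 0] by (rule mult_right_mono) simp
  finally show ?case
    by simp
next
  case (Suc n)
  let ?B = "(2 / R) ^ n * (norm x * norm y / below)" and ?u = "(L ^^ n) x"
  let ?g = "\<lambda>z. cinner (resolvent z (L ?u)) y"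
  have sphere: "cmod (?g w) \<le> 2 / R * ?B" if w: "cmod w = R" for w
  proof -
    \<comment> \<open>The induction hypothesis at \<open>z = 0\<close>, where the resolvent is the
      identity.\<close>
    have "cmod (cinner ?u y) \<le> ?B"
      using Suc.IH[of 0] R_pos by simp
    moreover have "cmod (cinner (resolvent w ?u) y) \<le> ?B"
      using Suc.IH[of w] w by simp
    moreover have "w * ?g w = cinner (resolvent w ?u) y - cinner ?u y"
      using resolvent_image[of w ?u] w by (simp flip: cinner_scaleC_left cinner_diff_left)
    ultimately have "cmod (w * ?g w) \<le> 2 * ?B"
      using norm_triangle_ineq4[of "cinner (resolvent w ?u) y" "cinner ?u y"] by simp
    then have "cmod (?g w) \<le> 2 * ?B / R"
      unfolding norm_mult w using R_pos by (subst pos_le_divide_eq) (simp_all only: mult.commute)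
    then show ?thesis
      by (simp add: mult.commute)
  qed
  have "cmod (?g z) \<le> 2 / R * ?B"
  proof (rule maximum_modulus_frontier[of ?g "cball 0 R"])
    show "?g holomorphic_on interior (cball 0 R)"
      using holomorphic_resolvent interior_subset by (rule holomorphic_on_subset)
    show "continuous_on (closure (cball 0 R)) ?g"
      using holomorphic_on_imp_continuous_on[OF holomorphic_resolvent] by simp
  qed (use sphere Suc.prems R_pos in auto)
  then show ?case
    by simp
qed

text \<open>The preceding bound at \<open>z = 0\<close>, tested against
  \<open>y = (L ^^ n) x\<close>.\<close>

lemma norm_power_le: "norm ((L ^^ n) x) \<le> (2 / R) ^ n * (norm x / below)"
proof (cases "(L ^^ n) x = 0")
  case False
  let ?y = "(L ^^ n) x"
  have "norm ?y * norm ?y \<le> (2 / R) ^ n * (norm x / below) * norm ?y"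
    using cinner_resolvent_power_le[of 0 n x ?y] R_pos
    by (simp add: cinner_self norm_mult power2_eq_square)
  then show ?thesis
    using False by (metis mult_right_le_imp_le zero_less_norm_iff)
qed (use R_pos below_pos in simp)

end

section \<open>Lifting idempotents modulo the compact operators\<close>

text \<open>Consecutive coefficients have ratio of modulus
  \<open>(n + 1/2) / (n + 1) \<le> 1\<close>.\<close>

lemma abs_gbinomial_minus_half_le_1: "\<bar>(- (1 / 2) :: real) gchoose n\<bar> \<le> 1"
proof (induction n)
  case (Suc n)
  have eq: "real (Suc n) * ((- (1 / 2)) gchoose Suc n) = (- (1 / 2) - real n) * ((- (1 / 2)) gchoose n)"
    using gbinomial_absorption[of n "- (1 / 2) :: real"] gbinomial_absorb_comp[of "- (1 / 2) :: real" n]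
    by simp
  have "real (Suc n) * \<bar>(- (1 / 2) :: real) gchoose Suc n\<bar> = \<bar>real (Suc n) * ((- (1 / 2)) gchoose Suc n)\<bar>"
    by (simp add: abs_mult)
  also have "\<dots> = \<bar>- (1 / 2) - real n\<bar> * \<bar>(- (1 / 2) :: real) gchoose n\<bar>"
    unfolding eq abs_mult ..
  also have "\<dots> \<le> real (Suc n) * 1"
    using Suc by (intro mult_mono) auto
  finally show ?case
    by simp
qed simp

lemma gbinomial_minus_one: "(- 1 :: real) gchoose n = (- 1) ^ n"
  using gbinomial_minus[of "1 :: real" n] by (simp flip: binomial_gbinomial)

section \<open>Power series in an operator whose powers decay geometrically\<close>

locale geometric_powers =
  fixes M :: "'a::complex_hilbert \<Rightarrow> 'a" and C :: real
  assumes clinear: "bounded_clinear M"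
    and norm_funpow: "norm ((M ^^ n) x) \<le> C * norm x * (1 / 2) ^ n"
begin

text \<open>Evaluated pointwise; the decay of the powers gives absolute convergence as soon as all
  coefficients have modulus at most 1.\<close>

definition op_series :: "(nat \<Rightarrow> real) \<Rightarrow> 'a \<Rightarrow> 'a"
  where "op_series a x = (\<Sum>n. a n *\<^sub>R (M ^^ n) x)"

lemma norm_term_le: "\<bar>c\<bar> \<le> 1 \<Longrightarrow> norm (c *\<^sub>R (M ^^ n) x) \<le> C * norm x * (1 / 2) ^ n"
  using norm_funpow[of n x] by (simp add: order_trans[OF mult_left_le_one_le])

lemma summable_majorant: "summable (\<lambda>n. C * norm (x :: 'a) * (1 / 2) ^ n)"
  by (intro summable_mult summable_geometric) simp

lemma summable_norm_op_series:
  "\<forall>n. \<bar>a n\<bar> \<le> 1 \<Longrightarrow> summable (\<lambda>n. norm (a n *\<^sub>R (M ^^ n) x))"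
  by (rule summable_comparison_test'[OF summable_majorant[of x], of 0]) (simp add: norm_term_le del: norm_scaleR)

lemma op_series_sums:
  "\<forall>n. \<bar>a n\<bar> \<le> 1 \<Longrightarrow> (\<lambda>n. a n *\<^sub>R (M ^^ n) x) sums op_series a x"
  unfolding op_series_def by (rule summable_sums[OF summable_norm_cancel[OF summable_norm_op_series]])

lemma op_series_has_sum:
  "\<forall>n. \<bar>a n\<bar> \<le> 1 \<Longrightarrow> ((\<lambda>n. a n *\<^sub>R (M ^^ n) x) has_sum op_series a x) UNIV"
  by (rule norm_summable_imp_has_sum[OF summable_norm_op_series op_series_sums])

lemma bounded_clinear_power: "bounded_clinear (M ^^ n)"
proof (induction n)
  case (Suc n)
  then show ?case
    using bounded_clinear_compose[OF clinear Suc] by (simp add: o_def)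
qed (simp add: bounded_clinear_id id_def)

lemma op_series_commute:
  assumes a: "\<forall>n. \<bar>a n\<bar> \<le> 1" and A: "bounded_clinear A" and comm: "\<And>x. A (M x) = M (A x)"
  shows "A (op_series a x) = op_series a (A x)"
proof -
  have "A ((M ^^ n) y) = (M ^^ n) (A y)" for n y
    by (induction n) (simp_all add: comm)
  then have "A (a n *\<^sub>R (M ^^ n) x) = a n *\<^sub>R (M ^^ n) (A x)" for n
    by (simp add: scaleR_scaleC bounded_clinear_scaleC[OF A])
  then have "(\<lambda>n. a n *\<^sub>R (M ^^ n) (A x)) sums A (op_series a x)"
    using bounded_linear.sums[OF bounded_clinear_imp_bounded_linear[OF A] op_series_sums[OF a, of x]]
    by simp
  then show ?thesis
    by (rule sums_unique2[OF _ op_series_sums[OF a]])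
qed

lemma bounded_clinear_op_series:
  assumes a: "\<forall>n. \<bar>a n\<bar> \<le> 1"
  shows "bounded_clinear (op_series a)"
proof (rule bounded_clinearI)
  show "op_series a (x + y) = op_series a x + op_series a y" for x y
  proof -
    have "(\<lambda>n. a n *\<^sub>R (M ^^ n) (x + y)) sums (op_series a x + op_series a y)"
      using sums_add[OF op_series_sums[OF a] op_series_sums[OF a]]
      by (simp add: bounded_clinear_add[OF bounded_clinear_power] scaleR_add_right)
    then show ?thesis
      by (rule sums_unique2[OF op_series_sums[OF a]])
  qed
  show "op_series a (c *\<^sub>C x) = c *\<^sub>C op_series a x" for c x
    by (rule op_series_commute[OF a bounded_clinear_scaled[OF bounded_clinear_id], symmetric])
      (simp add: bounded_clinear_scaleC[OF clinear])
  show "norm (op_series a x) \<le> norm x * (2 * C)" for x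
  proof -
    have "norm (op_series a x) \<le> (\<Sum>n. norm (a n *\<^sub>R (M ^^ n) x))"
      unfolding op_series_def using summable_norm_op_series[OF a] by (rule summable_norm)
    also have "\<dots> \<le> (\<Sum>n. C * norm x * (1 / 2) ^ n)"
      by (intro suminf_le norm_term_le a[rule_format] a summable_norm_op_series summable_majorant)
    also have "\<dots> = norm x * (2 * C)"
      by (subst suminf_mult) (simp_all add: suminf_geometric summable_geometric)
    finally show ?thesis .
  qed
qed

text \<open>Cauchy product: the double family \<open>f\<close> is dominated by a product of
  geometric series, so it may be summed by rows or by antidiagonals.\<close>

lemma op_series_mult:
  assumes a: "\<forall>n. \<bar>a n\<bar> \<le> 1" and b: "\<forall>n. \<bar>b n\<bar> \<le> 1"
  shows "op_series a (op_series b x) = op_series (\<lambda>n. \<Sum>i\<le>n. a i * b (n - i)) x"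
proof -
  define f where "f = (\<lambda>(i, j). (a i * b j) *\<^sub>R (M ^^ (i + j)) x)"
  define g where "g = (\<lambda>(i, j). C * norm x * (1 / 2) ^ i * (1 / 2) ^ j :: real)"
  have geo: "(\<lambda>n. (1 / 2) ^ n :: real) sums 2"
    using geometric_sums[of "1 / 2 :: real"] by simp
  have C0: "C * norm x \<ge> 0"
    using order_trans[OF norm_ge_zero norm_funpow[of 0 x]] by simp
  have "g summable_on (UNIV \<times> UNIV)"
  proof (rule summable_on_SigmaI)
    show "((\<lambda>j. g (i, j)) has_sum C * norm x * (1 / 2) ^ i * 2) UNIV" for i
      unfolding g_def prod.case using C0
      by (intro norm_summable_imp_has_sum sums_mult geo)
        (auto simp: abs_mult intro!: summable_mult summable_geometric)
    show "(\<lambda>i. C * norm x * (1 / 2) ^ i * 2) summable_on UNIV"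
      using C0 by (intro norm_summable_imp_summable_on)
        (auto simp: abs_mult intro!: summable_mult summable_mult2 summable_geometric)
  qed (use C0 in \<open>simp add: g_def\<close>)
  moreover have "norm (f p) \<le> g p" if "p \<in> UNIV \<times> UNIV" for p
  proof -
    obtain i j where p: "p = (i, j)"
      by force
    have "\<bar>a i * b j\<bar> \<le> 1"
      using a b by (simp add: abs_mult mult_le_one)
    then show ?thesis
      using norm_term_le[of "a i * b j" "i + j" x] unfolding p f_def g_def prod.case
      by (simp add: power_add mult.assoc)
  qed
  ultimately have "(\<lambda>p. norm (f p)) summable_on (UNIV \<times> UNIV)"
    by (rule Infinite_Sum.abs_summable_on_comparison_test'[of g])
  then obtain s where s: "(f has_sum s) (UNIV \<times> UNIV)"
    using abs_summable_summable summable_on_def by blast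
  \<comment> \<open>Summation by rows gives the composition of the two series.\<close>
  have "((\<lambda>i. a i *\<^sub>R (M ^^ i) (op_series b x)) has_sum s) UNIV"
  proof (rule has_sum_SigmaD[OF s])
    fix i
    have "bounded_linear (\<lambda>y. a i *\<^sub>R (M ^^ i) y)"
      by (intro bounded_linear_const_scaleR bounded_clinear_imp_bounded_linear bounded_clinear_power)
    from has_sum_bounded_linear[OF this op_series_has_sum[OF b]]
    show "((\<lambda>j. f (i, j)) has_sum a i *\<^sub>R (M ^^ i) (op_series b x)) UNIV"
      by (simp add: o_def f_def funpow_add scaleR_scaleC scaleC_scaleC
          bounded_clinear_scaleC[OF bounded_clinear_power])
  qed
  then have "op_series a (op_series b x) = s"
    using has_sum_unique op_series_has_sum[OF a] by blast
  \<comment> \<open>Reindexing by \<open>n = i + j\<close> gives the antidiagonals.\<close>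
  moreover have "((\<lambda>(n, i). f (i, n - i)) has_sum s) (SIGMA n:UNIV. {..n})"
    using s
    by (subst has_sum_reindex_bij_witness[where i = "\<lambda>(i, j). (i + j, i)" and j = "\<lambda>(n, i). (i, n - i)"
          and T = "UNIV \<times> UNIV" and h = f]) auto
  then have "((\<lambda>n. \<Sum>i\<le>n. f (i, n - i)) has_sum s) UNIV"
    by (rule has_sum_SigmaD) (auto intro: has_sum_finite)
  then have "(\<lambda>n. \<Sum>i\<le>n. f (i, n - i)) sums s"
    by (rule has_sum_imp_sums)
  then have "(\<lambda>n. (\<Sum>i\<le>n. a i * b (n - i)) *\<^sub>R (M ^^ n) x) sums s"
    by (simp add: f_def scaleR_sum_left)
  ultimately show ?thesis
    unfolding op_series_def by (simp add: sums_iff)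
qed

text \<open>The binomial series of \<open>1 + M\<close> to the power -1/2.\<close>

definition inv_sqrt :: "'a \<Rightarrow> 'a"
  where "inv_sqrt = op_series (\<lambda>n. (- (1 / 2)) gchoose n)"

lemma bounded_clinear_inv_sqrt: "bounded_clinear inv_sqrt"
  unfolding inv_sqrt_def by (intro bounded_clinear_op_series allI abs_gbinomial_minus_half_le_1)

lemma inv_sqrt_commute:
  "bounded_clinear A \<Longrightarrow> (\<And>x. A (M x) = M (A x)) \<Longrightarrow> A (inv_sqrt x) = inv_sqrt (A x)"
  unfolding inv_sqrt_def by (rule op_series_commute) (simp_all only: abs_gbinomial_minus_half_le_1 simp_thms)

lemma op_series_split_head:
  assumes a: "\<forall>n. \<bar>a n\<bar> \<le> 1"
  shows "op_series a x = a 0 *\<^sub>R x + M (op_series (\<lambda>n. a (Suc n)) x)"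
proof -
  have "(\<lambda>n. M (a (Suc n) *\<^sub>R (M ^^ n) x)) sums M (op_series (\<lambda>n. a (Suc n)) x)"
    by (rule bounded_linear.sums[OF bounded_clinear_imp_bounded_linear[OF clinear] op_series_sums])
      (use a in simp)
  then have "(\<lambda>n. a (Suc n) *\<^sub>R (M ^^ Suc n) x) sums M (op_series (\<lambda>n. a (Suc n)) x)"
    by (simp add: scaleR_scaleC bounded_clinear_scaleC[OF clinear])
  then have "(\<lambda>n. a n *\<^sub>R (M ^^ n) x) sums (M (op_series (\<lambda>n. a (Suc n)) x) + a 0 *\<^sub>R (M ^^ 0) x)"
    using sums_Suc[of "\<lambda>n. a n *\<^sub>R (M ^^ n) x"] by blast
  then show ?thesis
    using op_series_sums[OF a, of x] sums_unique2 by (fastforce simp: add.commute)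
qed

text \<open>Vandermonde's convolution turns the squared series into the one with coefficients
  \<open>(- 1) ^ n\<close>, and splitting off its first term shows that it inverts
  \<open>1 + M\<close>.\<close>

lemma inv_sqrt_square: "inv_sqrt (inv_sqrt x) + M (inv_sqrt (inv_sqrt x)) = x"
proof -
  have "(\<Sum>i\<le>n. ((- (1 / 2) :: real) gchoose i) * ((- (1 / 2)) gchoose (n - i))) = (- 1) ^ n" for n
  proof -
    have "- (1 / 2) + - (1 / 2) = (- 1 :: real)"
      by simp
    then show ?thesis
      using gbinomial_Vandermonde[of "- (1 / 2) :: real" "- (1 / 2)" n]
      unfolding atLeast0AtMost gbinomial_minus_one[symmetric] by metis
  qed
  then have sq: "inv_sqrt (inv_sqrt x) = op_series (\<lambda>n. (- 1) ^ n) x"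
    unfolding inv_sqrt_def by (subst op_series_mult) (simp_all add: abs_gbinomial_minus_half_le_1)
  have "op_series (\<lambda>n. (- 1) ^ Suc n) x = - op_series (\<lambda>n. (- 1) ^ n) x"
    using op_series_sums[of "\<lambda>n. (- 1) ^ n" x] unfolding op_series_def
    by (simp add: suminf_minus sums_iff)
  then have "op_series (\<lambda>n. (- 1) ^ n) x = x + M (- op_series (\<lambda>n. (- 1) ^ n) x)"
    using op_series_split_head[of "\<lambda>n. (- 1) ^ n" x] by simp
  moreover have "M (- y) = - M y" for y
    using bounded_clinear_scaleC[OF clinear, of "- 1" y] by simp
  ultimately show ?thesis
    unfolding sq by (metis add.commute add_uminus_conv_diff diff_add_cancel)
qed

text \<open>The inverse square root differs from the identity by a multiple of \<open>M\<close>,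
  hence by a compact operator when \<open>M\<close> is compact.\<close>

lemma inv_sqrt_eq: "inv_sqrt x = x + M (op_series (\<lambda>n. (- (1 / 2)) gchoose Suc n) x)"
  unfolding inv_sqrt_def by (subst op_series_split_head) (simp_all add: abs_gbinomial_minus_half_le_1)

end

section \<open>From the inverse square root to an idempotent\<close>

lemma scaleC_2: "(2 :: complex) *\<^sub>C x = x + x"
  using scaleC_add_left[of 1 1 x] by simp

lemma idempotent_near:
  fixes T :: "'a::complex_hilbert \<Rightarrow> 'a"
  assumes T: "bounded_clinear T" and L: "injective_pencil L 16" and TT: "\<And>x. T (T x) = T x + L x"
  shows "\<exists>S. idempotent_operator S \<and> compact_operator (\<lambda>x. T x - S x)"
proof -
  interpret L: injective_pencil L 16
    by (rule L)
  define M where "M = (\<lambda>x. 4 *\<^sub>C L x)"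
  have pow: "(M ^^ n) x = (4 ^ n) *\<^sub>C (L ^^ n) x" for n x
    by (induction n) (simp_all add: M_def bounded_clinear_scaleC[OF L.clinear] scaleC_scaleC mult.commute)
  \<comment> \<open>The radius 16 is chosen so that the growth rate of the powers of
    \<open>4 L\<close> is \<open>4 * (2 / 16) = 1 / 2\<close>.\<close>
  interpret M: geometric_powers M "1 / L.below"
  proof
    show "bounded_clinear M"
      unfolding M_def by (rule bounded_clinear_scaled[OF L.clinear])
    fix n x
    have "cmod (4 ^ n) = 4 ^ n"
      by (simp add: norm_power)
    then have "norm ((M ^^ n) x) \<le> 4 ^ n * ((2 / 16) ^ n * (norm x / L.below))"
      unfolding pow norm_scaleC using mult_left_mono[OF L.norm_power_le[of n x], of "4 ^ n"] by simp
    also have "\<dots> = (4 * (2 / 16)) ^ n * (norm x / L.below)"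
      by (simp only: power_mult_distrib mult.assoc)
    also have "\<dots> = 1 / L.below * norm x * (1 / 2) ^ n"
      by simp
    finally show "norm ((M ^^ n) x) \<le> 1 / L.below * norm x * (1 / 2) ^ n" .
  qed
  define N where "N = (\<lambda>x. 2 *\<^sub>C T x - x)"
  have N: "bounded_clinear N"
    unfolding N_def by (intro bounded_clinear_minus bounded_clinear_scaled bounded_clinear_id T)
  have LT: "L x = T (T x) - T x" for x
    by (simp add: TT)
  have Nh: "T x = (1/2) *\<^sub>C (x + N x)" for x
    by (simp add: N_def scaleC_scaleC)
  have NN: "N (N x) = x + M x" for x
  proof -
    have "(4 :: complex) *\<^sub>C y = y + y + y + y" for y :: 'a
      using scaleC_add_left[of 2 2 y] by (simp add: scaleC_2 add.assoc)
    then show ?thesis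
      by (simp add: N_def M_def LT scaleC_2 bounded_clinear_diff[OF T] bounded_clinear_add[OF T]
          algebra_simps)
  qed
  \<comment> \<open>\<open>N\<close> commutes with its own square, which is \<open>1 + M\<close>;
    cancelling \<open>N x\<close> leaves the claim.\<close>
  have NM: "N (M x) = M (N x)" for x
  proof -
    have "N (N x + M x - N x) = (N x + M (N x)) - N x"
      using NN[of x] NN[of "N x"] bounded_clinear_add[OF N, of x "M x"]
      by simp
    then show ?thesis
      by simp
  qed
  define Y where "Y = (\<lambda>x. N (M.inv_sqrt x))"
  have Y: "bounded_clinear Y"
    unfolding Y_def by (rule bounded_clinear_compose[OF N M.bounded_clinear_inv_sqrt])
  have YY: "Y (Y x) = x" for x
    unfolding Y_def M.inv_sqrt_commute[OF N NM, symmetric] NN by (rule M.inv_sqrt_square)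
  define S where "S = (\<lambda>x. (1/2) *\<^sub>C (x + Y x))"
  have S: "bounded_clinear S"
    unfolding S_def by (intro bounded_clinear_plus bounded_clinear_scaled bounded_clinear_id Y)
  have "S (S x) = S x" for x
  proof -
    have "Y (S x) = S x"
      by (simp add: S_def bounded_clinear_scaleC[OF Y] bounded_clinear_add[OF Y] YY add.commute)
    then have "S (S x) = (1/2) *\<^sub>C (2 *\<^sub>C S x)"
      unfolding S_def[THEN fun_cong, of "S x"] by (simp add: scaleC_2)
    then show ?thesis
      by (simp add: scaleC_scaleC)
  qed
  then have "idempotent_operator S"
    using S by (simp add: idempotent_operator_def fun_eq_iff)
  moreover have "compact_operator (\<lambda>x. T x - S x)"
  proof -
    define B where "B = M.op_series (\<lambda>n. (- (1 / 2)) gchoose Suc n)"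
    have B: "bounded_clinear B"
      unfolding B_def by (intro M.bounded_clinear_op_series allI abs_gbinomial_minus_half_le_1)
    have "compact_operator M"
      unfolding M_def by (rule compact_operator_scaled[OF L.compact_op])
    then have "compact_operator (\<lambda>x. (- 1/2) *\<^sub>C N (M (B x)))"
      by (intro compact_operator_scaled compact_operator_left[OF N] compact_operator_right[OF _ B])
    \<comment> \<open>By \<open>inv_sqrt_eq\<close>, \<open>Y = N + N M B\<close>, while
      \<open>T\<close> and \<open>S\<close> are \<open>(1 + N) / 2\<close> and
      \<open>(1 + Y) / 2\<close>.\<close>
    moreover have "T x - S x = (- 1/2) *\<^sub>C N (M (B x))" for x
    proof -
      have "T x - S x = (1/2) *\<^sub>C (N x - Y x)"
        unfolding Nh S_def by (simp flip: complex_vector.scale_right_diff_distrib)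
      also have "N x - Y x = - N (M (B x))"
        by (simp add: Y_def B_def M.inv_sqrt_eq bounded_clinear_add[OF N])
      finally show ?thesis
        by simp
    qed
    ultimately show ?thesis
      by simp
  qed
  ultimately show ?thesis
    by blast
qed

lemma essentially_idempotent_lift:
  fixes T :: "'a::complex_hilbert \<Rightarrow> 'a"
  assumes T: "bounded_clinear T" and ess: "essentially_idempotent T"
  shows "\<exists>S. idempotent_operator S \<and> compact_operator (\<lambda>x. T x - S x)"
proof -
  define K where "K = (\<lambda>x. T (T x) - T x)"
  have K: "compact_operator K"
    using ess by (simp add: essentially_idempotent_def K_def)
  have Kc: "bounded_clinear K"
    using K compact_operator_clinear by blast
  have comm: "K (T x) = T (K x)" for x
    by (simp add: K_def bounded_clinear_diff[OF T])
  obtain F where F: "reducing_subspace K T F"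
    and Fin: "\<And>l x. cmod l \<ge> 1/16 \<Longrightarrow> \<forall>v\<in>F. cinner x v = 0 \<Longrightarrow> l *\<^sub>C x - K x \<in> F \<Longrightarrow> x = 0"
    using exists_reducing_subspace[OF K T comm, of "1/16"] by auto
  interpret F: closed_csubspace F
    using F by (simp add: reducing_subspace_def)
  let ?P = "orth_proj F"
  have P: "compact_operator ?P"
    using F by (simp add: reducing_subspace_def)
  define Q where "Q = (\<lambda>x. x - ?P x)"
  have Q: "bounded_clinear Q"
    unfolding Q_def by (intro bounded_clinear_minus bounded_clinear_id F.bounded_clinear_orth_proj)
  have Q0: "Q x = 0" if "x \<in> F" for x
    using that by (simp add: Q_def F.orth_proj_id)
  have QQ: "Q (Q x) = Q x" for x
    using bounded_clinear_diff[OF Q, of x "?P x"] Q0[OF F.orth_proj_in] by (simp add: Q_def)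
  \<comment> \<open>Invariance of \<open>F\<close> kills \<open>Q T P\<close>, so compression by
    \<open>Q\<close> respects products and the quadratic relation survives.\<close>
  have QTQ: "Q (T (Q x)) = Q (T x)" for x
  proof -
    have "T (?P x) \<in> F"
      using F F.orth_proj_in by (auto simp: reducing_subspace_def)
    then have "Q (T (?P x)) = 0"
      by (rule Q0)
    then show ?thesis
      by (simp add: Q_def[THEN fun_cong, of x] bounded_clinear_diff[OF T] bounded_clinear_diff[OF Q])
  qed
  define T' where "T' = (\<lambda>x. Q (T x))"
  define L where "L = (\<lambda>x. Q (K x))"
  have T': "bounded_clinear T'"
    unfolding T'_def by (rule bounded_clinear_compose[OF Q T])
  have "injective_pencil L 16"
  proof
    show "compact_operator L"
      unfolding L_def by (rule compact_operator_left[OF Q K])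
    \<comment> \<open>A solution lies in the range of \<open>Q\<close>, hence is orthogonal to
      \<open>F\<close>, and \<open>inverse z *\<^sub>C x - K x\<close> lies in \<open>F\<close>. As
      \<open>inverse z\<close> has modulus at least \<open>1/16\<close>, the choice of
      \<open>F\<close> gives \<open>x = 0\<close>.\<close>
    fix z x assume z: "cmod z \<le> 16" and x: "x = z *\<^sub>C L x"
    show "x = 0"
    proof (cases "z = 0")
      case False
      have "inverse z *\<^sub>C x = L x"
        using False by (subst x) (simp add: scaleC_scaleC)
      then have "inverse z *\<^sub>C x - K x = - ?P (K x)"
        by (simp add: L_def Q_def)
      also have "\<dots> \<in> F"
        by (intro complex_vector.subspace_neg F.subspace F.orth_proj_in)
      finally have "inverse z *\<^sub>C x - K x \<in> F" .
      moreover have "cinner x v = 0" if "v \<in> F" for v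
        using F.cinner_orth_proj[OF that, of "K x"]
        by (subst x) (simp add: L_def Q_def cinner_scaleC_left)
      moreover have "cmod (inverse z) \<ge> 1/16"
        using le_imp_inverse_le[of "cmod z" 16] z False by (simp add: norm_inverse)
      ultimately show ?thesis
        using Fin by blast
    qed (use x in simp)
  qed simp
  moreover have "T' (T' x) = T' x + L x" for x
    by (simp add: T'_def L_def K_def QTQ bounded_clinear_diff[OF Q])
  ultimately obtain S where S: "idempotent_operator S" "compact_operator (\<lambda>x. T' x - S x)"
    using idempotent_near[OF T'] by blast
  \<comment> \<open>The compression differs from \<open>T\<close> by \<open>?P\<close> composed with
    \<open>T\<close>, which is compact.\<close>
  have "compact_operator (\<lambda>x. (T' x - S x) + ?P (T x))"
    by (rule compact_operator_plus[OF S(2) compact_operator_right[OF P T]])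
  then have "compact_operator (\<lambda>x. T x - S x)"
    by (simp add: T'_def Q_def algebra_simps)
  with S(1) show ?thesis
    by blast
qed

section \<open>Finite-dimensional subspaces\<close>

text \<open>A Gram-Schmidt step for each generator: a rank-one correction restores the residual
  \<open>e = b - P b\<close>, and it vanishes on vectors already fixed by \<open>P\<close>.\<close>

lemma compact_operator_fixing_span:
  assumes "finite B"
  shows "\<exists>P :: 'a::complex_inner \<Rightarrow> 'a. compact_operator P \<and> (\<forall>v\<in>complex_vector.span B. P v = v)"
  using assms
proof (induction B)
  case empty
  show ?case
    by (intro exI[of _ "\<lambda>x. 0"]) (simp add: compact_operator_zero)
next
  case (insert b B)
  then obtain P :: "'a \<Rightarrow> 'a" where P: "compact_operator P" "\<And>v. v \<in> complex_vector.span B \<Longrightarrow> P v = v"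
    by blast
  have Pc: "bounded_clinear P"
    using P(1) by (rule compact_operator_clinear)
  define e where "e = b - P b"
  define P' where "P' = (\<lambda>x. P x + cinner (x - P x) (inverse (cinner e e) *\<^sub>C e) *\<^sub>C e)"
  have "bounded_clinear (\<lambda>x. x - P x)"
    by (intro bounded_clinear_minus bounded_clinear_id Pc)
  then have P': "compact_operator P'"
    unfolding P'_def by (intro compact_operator_plus P(1)
        compact_operator_right[OF compact_operator_rank_one[of "inverse (cinner e e) *\<^sub>C e" e]])
  have P'c: "bounded_clinear P'"
    using P' by (rule compact_operator_clinear)
  have fix_gen: "P' v = v" if "v \<in> insert b B" for v
  proof (cases "v = b")
    case True
    \<comment> \<open>If \<open>e = 0\<close>, the convention \<open>inverse 0 = 0\<close> is
      harmless, as both sides vanish.\<close>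
    have "cinner e (inverse (cinner e e) *\<^sub>C e) *\<^sub>C e = e"
      by (cases "e = 0") (simp_all add: cinner_scaleC_right cinner_self)
    then show ?thesis
      using True by (simp add: P'_def flip: e_def) (simp add: e_def)
  next
    case False
    then have "P v = v"
      using that by (intro P(2) complex_vector.span_base) simp
    then show ?thesis
      by (simp add: P'_def)
  qed
  have "P' v = v" if "v \<in> complex_vector.span (insert b B)" for v
    using that
  proof (induction rule: complex_vector.span_induct_alt)
    case base
    then show ?case
      by (simp add: bounded_clinear_zero[OF P'c])
  next
    case (step c x y)
    then show ?case
      by (simp add: bounded_clinear_add[OF P'c] bounded_clinear_scaleC[OF P'c] fix_gen)
  qed
  with P' show ?case
    by blast
qed

lemma compact_operator_fixing:
  assumes "\<not> infinite_dimensional V"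
  obtains P where "compact_operator P" "\<And>v. v \<in> V \<Longrightarrow> P v = v"
  using assms compact_operator_fixing_span unfolding infinite_dimensional_def by metis

lemma compact_operator_of_finite_dimensional_range:
  assumes S: "bounded_clinear S" and fin: "\<not> infinite_dimensional (range S)"
  shows "compact_operator S"
proof -
  obtain P where P: "compact_operator P" "\<And>v. v \<in> range S \<Longrightarrow> P v = v"
    using compact_operator_fixing[OF fin] by blast
  then have "compact_operator (\<lambda>x. P (S x))"
    using compact_operator_right S by blast
  then show ?thesis
    using P(2) by simp
qed

text \<open>\<open>S - 1\<close> kills the range of \<open>S\<close>, so it only sees the component
  of \<open>x\<close> orthogonal to that range. This component lies in the kernel of the adjoint,
  where a compact operator acts as the identity.\<close>

lemma compact_operator_of_finite_dimensional_cokernel: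
  fixes S :: "'a::complex_hilbert \<Rightarrow> 'a"
  assumes S: "idempotent_operator S" and fin: "\<not> infinite_dimensional (null_space (cadjoint S))"
  shows "compact_operator (\<lambda>x. S x - x)"
proof -
  have Sc: "bounded_clinear S" and SS: "S (S x) = S x" for x
    using S by (auto simp: idempotent_operator_def fun_eq_iff)
  define D where "D = (\<lambda>x. S x - x)"
  have D: "bounded_clinear D"
    unfolding D_def by (intro bounded_clinear_minus bounded_clinear_id Sc)
  \<comment> \<open>The range of an idempotent is the kernel of \<open>S - 1\<close>, hence closed,
    so the projection onto it is available.\<close>
  have "range S = {x. D x = 0}"
    by (auto simp: D_def SS) (metis rangeI)
  then have range: "range S = D -` {0}"
    by auto
  interpret R: closed_csubspace "range S"
  proof
    show "complex_vector.subspace (range S)"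
      unfolding range
      by (simp add: complex_vector.subspace_def bounded_clinear_zero[OF D] bounded_clinear_add[OF D]
          bounded_clinear_scaleC[OF D])
    show "closed (range S)"
      unfolding range using bounded_clinear_imp_bounded_linear[OF D] linear_continuous_on
      by (intro closed_vimage) auto
  qed
  obtain P where P: "compact_operator P" "\<And>v. v \<in> null_space (cadjoint S) \<Longrightarrow> P v = v"
    using compact_operator_fixing[OF fin] by blast
  have "S x - x = S (P (x - orth_proj (range S) x)) - P (x - orth_proj (range S) x)" for x
  proof -
    let ?p = "orth_proj (range S) x"
    have "cinner (S y) (x - ?p) = 0" for y
      using R.cinner_orth_proj[of "S y" x] cinner_commute[of "S y" "x - ?p"] by simp
    then have "P (x - ?p) = x - ?p"
      by (intro P(2)) (simp add: null_space_cadjoint[OF Sc])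
    moreover have "S ?p = ?p"
      using R.orth_proj_in[of x] SS by auto
    ultimately show ?thesis
      by (simp add: bounded_clinear_diff[OF Sc])
  qed
  moreover have "compact_operator (\<lambda>x. S (P (x - orth_proj (range S) x)) - P (x - orth_proj (range S) x))"
  proof -
    have "bounded_clinear (\<lambda>x. x - orth_proj (range S) x)"
      by (intro bounded_clinear_minus bounded_clinear_id R.bounded_clinear_orth_proj)
    then have "compact_operator (\<lambda>x. P (x - orth_proj (range S) x))"
      by (rule compact_operator_right[OF P(1)])
    then show ?thesis
      using compact_operator_left[OF D] by (simp add: D_def)
  qed
  ultimately show ?thesis
    by simp
qed

section \<open>The two implications of the equivalence\<close>

lemma essentially_idempotent_perturbation:
  assumes T: "bounded_clinear T" and S: "idempotent_operator S" and C: "compact_operator (\<lambda>x. T x - S x)"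
  shows "essentially_idempotent T"
proof -
  have Sc: "bounded_clinear S" and SS: "S (S x) = S x" for x
    using S by (auto simp: idempotent_operator_def fun_eq_iff)
  \<comment> \<open>Since \<open>S\<close> is idempotent,
    \<open>T T - T = (T - S) S + T (T - S) - (T - S)\<close>.\<close>
  have "compact_operator (\<lambda>x. (T (S x) - S (S x)) + T (T x - S x) - (T x - S x))"
    by (intro compact_operator_minus compact_operator_plus C compact_operator_left[OF T C]
        compact_operator_right[OF C Sc])
  then show ?thesis
    by (simp add: essentially_idempotent_def SS bounded_clinear_diff[OF T])
qed

theorem theorem1p3:
  fixes T :: "'a::complex_hilbert \<Rightarrow> 'a"
  assumes "separable_space (euclidean :: 'a topology)"
    and "bounded_clinear T"
  shows "essentially_idempotent T \<longleftrightarrow>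
    compact_operator (\<lambda>x. T x - x) \<or>
    compact_operator T \<or>
    (\<exists>S. idempotent_operator S \<and> compact_operator (\<lambda>x. T x - S x) \<and>
         infinite_dimensional (range S) \<and> infinite_dimensional (null_space (cadjoint S)))"
proof
  assume "essentially_idempotent T"
  then obtain S where S: "idempotent_operator S" and TS: "compact_operator (\<lambda>x. T x - S x)"
    using essentially_idempotent_lift[OF assms(2)] by blast
  have Sc: "bounded_clinear S"
    using S by (simp add: idempotent_operator_def)
  show "compact_operator (\<lambda>x. T x - x) \<or> compact_operator T \<or>
    (\<exists>S. idempotent_operator S \<and> compact_operator (\<lambda>x. T x - S x) \<and>
         infinite_dimensional (range S) \<and> infinite_dimensional (null_space (cadjoint S)))"
  proof (cases "infinite_dimensional (range S)")
    \<comment> \<open>Here \<open>S\<close> itself is compact, which gives alternative (2); a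
      finite-dimensional cokernel gives alternative (1) below.\<close>
    case False
    then show ?thesis
      using compact_operator_plus[OF TS compact_operator_of_finite_dimensional_range[OF Sc]] by simp
  next
    case inf: True
    show ?thesis
    proof (cases "infinite_dimensional (null_space (cadjoint S))")
      case False
      then show ?thesis
        using compact_operator_plus[OF TS compact_operator_of_finite_dimensional_cokernel[OF S]] by simp
    qed (use S TS inf in blast)
  qed
next
  \<comment> \<open>Alternatives (1) and (2) are compact perturbations of the idempotents 1 and
    0.\<close>
  have "idempotent_operator (\<lambda>x::'a. x)" "idempotent_operator (\<lambda>x::'a. 0)"
    by (simp_all add: idempotent_operator_def bounded_clinear_id bounded_clinear_const_zero fun_eq_iff)
  moreover assume "compact_operator (\<lambda>x. T x - x) \<or> compact_operator T \<or>
    (\<exists>S. idempotent_operator S \<and> compact_operator (\<lambda>x. T x - S x) \<and>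
         infinite_dimensional (range S) \<and> infinite_dimensional (null_space (cadjoint S)))"
  ultimately show "essentially_idempotent T"
    using essentially_idempotent_perturbation[OF assms(2)] by fastforce
qed

end
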